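(* Let $K\geq2$ be even, let $T=(t_{ij})_{i,j=1,\ldots,K}$ be a real symmetric matrix, and let $\boldsymbol{S}=\sum_{i,j=1}^K t_{ij}\,\boldsymbol{a}_i^*\boldsymbol{a}_j$ be the corresponding one-particle operator on $(\mathbb{R}^2)^{\otimes K}$. With the cores $T_1,\ldots,T_K$ and the matrix $M_T$ defined in the context, $$\boldsymbol{S}=T_1\Join T_2\Join\cdots\Join T_{K/2}\,M_T\Join T_{K/2+1}\Join\cdots\Join T_K .$$ Furthermore, the MPO rank of $\boldsymbol{S}$ is bounded by $K+2$. If for some $d\in\mathbb{N}_0$ we have $t_{ij}=0$ whenever $|i-j|>d$, then the MPO ranks of $\boldsymbol{S}$ are bounded by $2d+2$.
   Context: Let $S=\begin{pmatrix}1&0\\ 0&-1\end{pmatrix}$, $A=\begin{pmatrix}0&1\\ 0&0\end{pmatrix}$, $I=\begin{pmatrix}1&0\\ 0&1\end{pmatrix}$. The annihilation operators on $(\mathbb{R}^2)^{\otimes K}$ are $\boldsymbol{a}_i=S^{\otimes(i-1)}\otimes A\otimes I^{\otimes(K-i)}$, and the creation operators are the adjoints $\boldsymbol{a}_i^*$. Matrix product operators (MPO): a core of size $r\times r'$ is an $r\times r'$ array $M=[M^{[j,j']}]$ of $2\times2$ matrices. The strong Kronecker product of arrays of compatible sizes is $(M\Join M')^{[j,j'']}=\sum_{j'}M^{[j,j']}\otimes M'^{[j',j'']}$; a $1\times1$ array is identified with its entry. A core is multiplied by a real matrix $G$ from the right by $(MG)^{[j,j'']}=\sum_{j'}M^{[j,j']}G_{j',j''}$.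 An MPO representation of an operator with ranks $(r_1,\ldots,r_{K-1})$, $r_0=r_K=1$, is a factorization $M_1\Join\cdots\Join M_K$ with $M_k$ of size $r_{k-1}\times r_k$. That the MPO rank(s) of an operator are bounded by $R$ means that it has an MPO representation with all $r_k\leq R$. For a real matrix $W$ and a $2\times2$ matrix $B$, $W\uparrow B$ is the core with entries $(W\uparrow B)^{[j,j']}=W_{jj'}B$. For $m\geq0$, $\mathsf{S}_m$ is the $m\times m$ core with $S$ on the diagonal and zeros elsewhere. Define column vectors $W^1_{T,k}=(t_{ik})_{i=1,\ldots,k-1}$ and $W^2_{T,k}=(t_{kj})_{j=1,\ldots,k-1}$; row vectors $W^3_{T,k}=(t_{kj})_{j=K,K-1,\ldots,k+1}$ and $W^4_{T,k}=(t_{ik})_{i=K,K-1,\ldots,k+1}$; and the $\frac K2\times\frac K2$ matrices $W^5_T$, with rows $i=1,\ldots,K/2$, columns $j=K,K-1,\ldots,K/2+1$ and entries $t_{ij}$, and $W^6_T$, with rows $j=1,\ldots,K/2$, columns $i=K,K-1,\ldots,K/2+1$ and entries $t_{ij}$. The cores are $$T_1=\begin{bmatrix}I & A & A^* & t_{1,1}A^*A\end{bmatrix},\qquad T_K=\begin{bmatrix} I \\ A \\ A^* \\ t_{K,K}A^*A\end{bmatrix};$$ for $k=2,\ldots,\frac K2$, $$T_k=\begin{bmatrix}I&0&A&0&A^*&t_{k,k}A^*A\\ 0&\mathsf{S}_{k-1}&0&0&0&W^1_{T,k}\uparrow A^*\\ 0&0&0&\mathsf{S}_{k-1}&0&W^2_{T,k}\uparrow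 A\\ 0&0&0&0&0&I\end{bmatrix};$$ for $k=\frac K2+1,\ldots,K-1$, $$T_k=\begin{bmatrix}I&0&0&0\\ 0&\mathsf{S}_{K-k}&0&0\\ A&0&0&0\\ 0&0&\mathsf{S}_{K-k}&0\\ A^*&0&0&0\\ t_{k,k}A^*A&W^3_{T,k}\uparrow A^*&W^4_{T,k}\uparrow A&I\end{bmatrix};$$ and $$M_T=\begin{pmatrix}0&0&0&1\\ 0&0&W^6_T&0\\ 0&W^5_T&0&0\\ 1&0&0&0\end{pmatrix}.$$ *)

theory Defs
  imports "Jordan_Normal_Form.Schur_Decomposition"
begin

subsection \<open>Tensor products of matrices\<close>

text \<open>The space $(\mathbb{R}^2)^{\otimes K}$ is identified with $\mathbb{R}^{2^K}$ through the
  lexicographically ordered product basis, so that an operator on it is a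
  \<open>2 ^ K \<times> 2 ^ K\<close> matrix and the tensor product of operators is the Kronecker product.\<close>

definition kron :: "real mat \<Rightarrow> real mat \<Rightarrow> real mat" (infixr \<open>\<otimes>\<^sub>m\<close> 75) where
  "A \<otimes>\<^sub>m B = mat (dim_row A * dim_row B) (dim_col A * dim_col B)
     (\<lambda>(i, j). A $$ (i div dim_row B, j div dim_col B) * B $$ (i mod dim_row B, j mod dim_col B))"

fun kron_pow :: "real mat \<Rightarrow> nat \<Rightarrow> real mat" where
  "kron_pow A 0 = 1\<^sub>m 1"
| "kron_pow A (Suc n) = A \<otimes>\<^sub>m kron_pow A n"

abbreviation mat_sum :: "nat \<Rightarrow> nat \<Rightarrow> ('i \<Rightarrow> real mat) \<Rightarrow> 'i set \<Rightarrow> real mat" where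
  "mat_sum nr nc f J \<equiv> finsum (module_mat TYPE(real) nr nc) f J"

subsection \<open>Annihilation and creation operators\<close>

definition mS :: "real mat" where
  "mS = mat_of_rows_list 2 [[1, 0], [0, -1]]"

definition mA :: "real mat" where
  "mA = mat_of_rows_list 2 [[0, 1], [0, 0]]"

definition mI :: "real mat" where
  "mI = 1\<^sub>m 2"

definition annihilation :: "nat \<Rightarrow> nat \<Rightarrow> real mat" where
  "annihilation K i = kron_pow mS (i - 1) \<otimes>\<^sub>m mA \<otimes>\<^sub>m kron_pow mI (K - i)"

definition creation :: "nat \<Rightarrow> nat \<Rightarrow> real mat" where
  "creation K i = mat_adjoint (annihilation K i)"

text \<open>Library matrices are indexed from 0; \<open>entry T i j\<close> is $t_{ij}$ with \<open>i, j \<ge> 1\<close>.\<close>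

definition entry :: "real mat \<Rightarrow> nat \<Rightarrow> nat \<Rightarrow> real" where
  "entry T i j = T $$ (i - 1, j - 1)"

definition one_particle_op :: "nat \<Rightarrow> real mat \<Rightarrow> real mat" where
  "one_particle_op K T = mat_sum (2 ^ K) (2 ^ K)
     (\<lambda>(i, j). entry T i j \<cdot>\<^sub>m (creation K i * annihilation K j)) ({1..K} \<times> {1..K})"

subsection \<open>Cores and matrix product operators\<close>

text \<open>An array of matrices is a matrix whose entries are matrices. All arrays in use are
  nonempty and their entries all have the same dimensions, which are therefore read off from
  the entry \<open>(0, 0)\<close>.\<close>

type_synonym core = "real mat mat"

definition is_core :: "nat \<Rightarrow> nat \<Rightarrow> core \<Rightarrow> bool" where
  "is_core r r' M \<longleftrightarrow> 0 < r \<and> 0 < r' \<and> M \<in> carrier_mat r r' \<and>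
     (\<forall>j<r. \<forall>j'<r'. M $$ (j, j') \<in> carrier_mat 2 2)"

definition strong_kron :: "core \<Rightarrow> core \<Rightarrow> core" (infixr \<open>\<Join>\<close> 70) where
  "M \<Join> M' = mat (dim_row M) (dim_col M') (\<lambda>(j, j'').
     mat_sum (dim_row (M $$ (0, 0)) * dim_row (M' $$ (0, 0)))
             (dim_col (M $$ (0, 0)) * dim_col (M' $$ (0, 0)))
       (\<lambda>j'. M $$ (j, j') \<otimes>\<^sub>m M' $$ (j', j'')) {..<dim_col M})"

text \<open>The strong Kronecker product is associative; longer products are bracketed to the right.\<close>

fun mpo_prod :: "core list \<Rightarrow> core" where
  "mpo_prod [] = mat 1 1 (\<lambda>_. 1\<^sub>m 1)"
| "mpo_prod [M] = M"
| "mpo_prod (M # N # Ms) = M \<Join> mpo_prod (N # Ms)"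

definition core_mult :: "core \<Rightarrow> real mat \<Rightarrow> core" where
  "core_mult M G = mat (dim_row M) (dim_col G) (\<lambda>(j, j'').
     mat_sum 2 2 (\<lambda>j'. G $$ (j', j'') \<cdot>\<^sub>m M $$ (j, j')) {..<dim_col M})"

text \<open>\<open>single\<close> is the identification of a matrix with the 1 by 1 array containing it.\<close>

definition single :: "'a \<Rightarrow> 'a mat" where
  "single B = mat 1 1 (\<lambda>_. B)"

definition mpo_representation :: "nat \<Rightarrow> (nat \<Rightarrow> nat) \<Rightarrow> (nat \<Rightarrow> core) \<Rightarrow> real mat \<Rightarrow> bool" where
  "mpo_representation K r M X \<longleftrightarrow> r 0 = 1 \<and> r K = 1 \<and>
     (\<forall>k\<in>{1..K}. is_core (r (k - 1)) (r k) (M k)) \<and>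
     mpo_prod (map M [1..<Suc K]) = single X"

definition mpo_ranks_bounded :: "nat \<Rightarrow> real mat \<Rightarrow> nat \<Rightarrow> bool" where
  "mpo_ranks_bounded K X R \<longleftrightarrow>
     (\<exists>r M. mpo_representation K r M X \<and> (\<forall>k\<in>{1..K - 1}. r k \<le> R))"

subsection \<open>Block arrays\<close>

definition hcat :: "'a mat \<Rightarrow> 'a mat \<Rightarrow> 'a mat" where
  "hcat A B = mat (dim_row A) (dim_col A + dim_col B)
     (\<lambda>(i, j). if j < dim_col A then A $$ (i, j) else B $$ (i, j - dim_col A))"

definition vcat :: "'a mat \<Rightarrow> 'a mat \<Rightarrow> 'a mat" where
  "vcat A B = mat (dim_row A + dim_row B) (dim_col A)
     (\<lambda>(i, j). if i < dim_row A then A $$ (i, j) else B $$ (i - dim_row A, j))"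

fun hcats :: "'a mat list \<Rightarrow> 'a mat" where
  "hcats [] = mat 0 0 undefined"
| "hcats [A] = A"
| "hcats (A # B # As) = hcat A (hcats (B # As))"

fun vcats :: "'a mat list \<Rightarrow> 'a mat" where
  "vcats [] = mat 0 0 undefined"
| "vcats [A] = A"
| "vcats (A # B # As) = vcat A (vcats (B # As))"

definition block_mat :: "'a mat list list \<Rightarrow> 'a mat" where
  "block_mat Bss = vcats (map hcats Bss)"

definition zero_core :: "nat \<Rightarrow> nat \<Rightarrow> core" where
  "zero_core r r' = mat r r' (\<lambda>_. 0\<^sub>m 2 2)"

definition S_core :: "nat \<Rightarrow> core" where
  "S_core m = mat m m (\<lambda>(i, j). if i = j then mS else 0\<^sub>m 2 2)"

definition uparrow_core :: "real mat \<Rightarrow> real mat \<Rightarrow> core" (infix \<open>\<up>\<close> 80) where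
  "W \<up> B = map_mat (\<lambda>w. w \<cdot>\<^sub>m B) W"

subsection \<open>The coefficient matrices\<close>

text \<open>With 0-based \<open>p\<close> and \<open>q\<close>, \<open>p + 1\<close> runs upwards from 1 and \<open>K - q\<close> downwards from \<open>K\<close>.\<close>

definition W1 :: "real mat \<Rightarrow> nat \<Rightarrow> real mat" where
  "W1 T k = mat (k - 1) 1 (\<lambda>(p, _). entry T (p + 1) k)"

definition W2 :: "real mat \<Rightarrow> nat \<Rightarrow> real mat" where
  "W2 T k = mat (k - 1) 1 (\<lambda>(p, _). entry T k (p + 1))"

definition W3 :: "nat \<Rightarrow> real mat \<Rightarrow> nat \<Rightarrow> real mat" where
  "W3 K T k = mat 1 (K - k) (\<lambda>(_, q). entry T k (K - q))"

definition W4 :: "nat \<Rightarrow> real mat \<Rightarrow> nat \<Rightarrow> real mat" where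
  "W4 K T k = mat 1 (K - k) (\<lambda>(_, q). entry T (K - q) k)"

definition W5 :: "nat \<Rightarrow> real mat \<Rightarrow> real mat" where
  "W5 K T = mat (K div 2) (K div 2) (\<lambda>(p, q). entry T (p + 1) (K - q))"

definition W6 :: "nat \<Rightarrow> real mat \<Rightarrow> real mat" where
  "W6 K T = mat (K div 2) (K div 2) (\<lambda>(p, q). entry T (K - q) (p + 1))"

definition M_mat :: "nat \<Rightarrow> real mat \<Rightarrow> real mat" where
  "M_mat K T = (let h = K div 2 in block_mat
     [[0\<^sub>m 1 1, 0\<^sub>m 1 h, 0\<^sub>m 1 h, 1\<^sub>m 1],
      [0\<^sub>m h 1, 0\<^sub>m h h, W6 K T,  0\<^sub>m h 1],
      [0\<^sub>m h 1, W5 K T,  0\<^sub>m h h, 0\<^sub>m h 1],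
      [1\<^sub>m 1,   0\<^sub>m 1 h, 0\<^sub>m 1 h, 0\<^sub>m 1 1]])"

subsection \<open>The cores\<close>

abbreviation mA_adj :: "real mat" where
  "mA_adj \<equiv> mat_adjoint mA"

abbreviation diag_op :: "real mat \<Rightarrow> nat \<Rightarrow> real mat" where
  "diag_op T k \<equiv> entry T k k \<cdot>\<^sub>m (mA_adj * mA)"

definition core_first :: "real mat \<Rightarrow> core" where
  "core_first T = block_mat [[single mI, single mA, single mA_adj, single (diag_op T 1)]]"

definition core_last :: "nat \<Rightarrow> real mat \<Rightarrow> core" where
  "core_last K T = block_mat [[single mI], [single mA], [single mA_adj], [single (diag_op T K)]]"

definition core_left :: "real mat \<Rightarrow> nat \<Rightarrow> core" where
  "core_left T k = (let m = k - 1; Z = zero_core in block_mat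
     [[single mI, Z 1 m,    single mA, Z 1 m,    single mA_adj, single (diag_op T k)],
      [Z m 1,     S_core m, Z m 1,     Z m m,    Z m 1,         W1 T k \<up> mA_adj],
      [Z m 1,     Z m m,    Z m 1,     S_core m, Z m 1,         W2 T k \<up> mA],
      [Z 1 1,     Z 1 m,    Z 1 1,     Z 1 m,    Z 1 1,         single mI]])"

definition core_right :: "nat \<Rightarrow> real mat \<Rightarrow> nat \<Rightarrow> core" where
  "core_right K T k = (let m = K - k; Z = zero_core in block_mat
     [[single mI,            Z 1 m,             Z 1 m,         Z 1 1],
      [Z m 1,                S_core m,          Z m m,         Z m 1],
      [single mA,            Z 1 m,             Z 1 m,         Z 1 1],
      [Z m 1,                Z m m,             S_core m,      Z m 1],
      [single mA_adj,        Z 1 m,             Z 1 m,         Z 1 1],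
      [single (diag_op T k), W3 K T k \<up> mA_adj, W4 K T k \<up> mA, single mI]])"

definition T_core :: "nat \<Rightarrow> real mat \<Rightarrow> nat \<Rightarrow> core" where
  "T_core K T k =
     (if k = 1 then core_first T
      else if k = K then core_last K T
      else if k \<le> K div 2 then core_left T k
      else core_right K T k)"

end

theory Submission
  imports Defs
begin

text \<open>
  Commuting the strings of signs through, each term of the one-particle operator is a string of
  2 by 2 matrices: for two different sites it consists of identities, a creation or annihilation at the
  first site, the sign matrix in between, the other operator at the second site and identities again.
  The sign matrix squares to the identity and is absorbed by the ladder operators at the two ends of the
  string in such a way that no sign remains (\<open>creation_annihilation_Suc\<close>). So a string can be read from
  left to right by an automaton that remembers whether nothing has happened yet, or which operator at
  which site is waiting for its partner, or that the string is complete. The left cores are the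
  transition matrices of this automaton. The right cores belong to the automaton that instead knows
  what is still to come, and the matrix in the middle converts between the two by attaching the
  coefficients of all pairs that are separated by the middle. Hence the number of states never exceeds
  the number reached there.

  The products are evaluated from the right. A suffix of the product is a column of operators on the
  remaining sites, one for each state: the sum of everything that leads from that state to a complete
  string. For the left cores these are the one-particle operator of the remaining sites, weighted sums
  of creations or of annihilations, and the identity. Splitting off one site gives recursions for these
  operators (\<open>op_tail_step\<close>, \<open>cre_sum_step\<close>, \<open>ann_sum_step\<close>), and each core is exactly the coefficient
  matrix of such a recursion (\<open>core_left_step\<close>, \<open>core_right_step\<close>, \<open>M_mat_right_col\<close>). By
  \<open>mpo_prod_eq_column\<close> this determines the product. The matrix in the middle can be multiplied into
  its left neighbour, which gives the bound by the number of states in the middle.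

  If coefficients vanish at distance more than \<open>d\<close>, an operator that has been waiting for \<open>d\<close> sites can
  be forgotten. The left automaton, used along the whole chain, then needs only one shift register of
  length \<open>d\<close> for annihilations and one for creations, besides its first and its last state
  (\<open>register_core_step\<close>). This covers all \<open>d\<close> at once.
\<close>

section \<open>Kronecker products\<close>

text \<open>The sums of matrices in the definitions are sums in an abelian group with explicit carrier,
  and the laws of such sums ask that all summands have the right dimensions. Once that is checked, only
  the sums of the entries matter.\<close>

lemma mat_sum_eq:
  assumes "finite J" and "\<And>j. j \<in> J \<Longrightarrow> f j \<in> carrier_mat nr nc"
  shows "mat_sum nr nc f J = mat nr nc (\<lambda>(a, b). \<Sum>j\<in>J. f j $$ (a, b))"
proof -
  interpret abelian_group "module_mat TYPE(real) nr nc" by (rule abelian_group_mat)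
  show ?thesis using assms
  proof (induction J rule: finite_induct)
    case empty
    then show ?case by (auto simp: module_mat_simps)
  next
    case (insert x F)
    then have "mat_sum nr nc f (insert x F) = f x + mat_sum nr nc f F"
      by (subst finsum_insert) (auto simp: module_mat_simps)
    with insert show ?case by (auto intro!: eq_matI)
  qed
qed

lemma adjoint_eq_transpose: "mat_adjoint (A :: real mat) = transpose_mat A"
  by (rule eq_matI) (simp_all add: mat_adjoint_def mat_of_rows_def)

lemma dim_kron [simp]:
  "dim_row (A \<otimes>\<^sub>m B) = dim_row A * dim_row B"
  "dim_col (A \<otimes>\<^sub>m B) = dim_col A * dim_col B"
  by (simp_all add: kron_def)

lemma kron_carrier [simp, intro]:
  "A \<in> carrier_mat m n \<Longrightarrow> B \<in> carrier_mat p q \<Longrightarrow> A \<otimes>\<^sub>m B \<in> carrier_mat (m * p) (n * q)"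
  by (intro carrier_matI) simp_all

lemma index_kron:
  "a < dim_row A * dim_row B \<Longrightarrow> b < dim_col A * dim_col B \<Longrightarrow>
    (A \<otimes>\<^sub>m B) $$ (a, b) =
      A $$ (a div dim_row B, b div dim_col B) * B $$ (a mod dim_row B, b mod dim_col B)"
  by (simp add: kron_def)

lemma div_mod_less_times:
  fixes a m n :: nat
  assumes "a < m * n"
  shows "a div n < m" "a mod n < n" "0 < m" "0 < n"
proof -
  show "0 < m" "0 < n" using assms by (cases m; cases n; simp)+
  then show "a mod n < n" by simp
  show "a div n < m" using assms by (rule less_mult_imp_div_less)
qed

text \<open>The three digits of an index into a threefold product are the same for both bracketings.\<close>

lemma kron_assoc: "(A \<otimes>\<^sub>m B) \<otimes>\<^sub>m C = A \<otimes>\<^sub>m (B \<otimes>\<^sub>m C)"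
proof (rule eq_matI)
  fix a b
  assume "a < dim_row (A \<otimes>\<^sub>m (B \<otimes>\<^sub>m C))" and "b < dim_col (A \<otimes>\<^sub>m (B \<otimes>\<^sub>m C))"
  then have a: "a < dim_row A * (dim_row B * dim_row C)"
    and b: "b < dim_col A * (dim_col B * dim_col C)" by simp_all
  have split: "i mod (m * n) div n = i div n mod m" "i mod (m * n) mod n = i mod n" for i m n :: nat
  proof -
    show "i mod (m * n) div n = i div n mod m"
      by (cases "n = 0") (simp_all add: mod_mult2_eq[of i n m] mult.commute[of m n])
    show "i mod (m * n) mod n = i mod n" by (simp add: mod_mod_cancel)
  qed
  have div: "i div (m * n) = i div n div m" for i m n :: nat
    by (metis div_mult2_eq mult.commute)
  have "a div dim_row C < dim_row A * dim_row B" "b div dim_col C < dim_col A * dim_col B"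
    by (rule less_mult_imp_div_less; use a b in \<open>simp add: mult.assoc\<close>)+
  then have "((A \<otimes>\<^sub>m B) \<otimes>\<^sub>m C) $$ (a, b) =
      A $$ (a div dim_row C div dim_row B, b div dim_col C div dim_col B) *
      B $$ (a div dim_row C mod dim_row B, b div dim_col C mod dim_col B) *
      C $$ (a mod dim_row C, b mod dim_col C)"
    using a b by (simp add: index_kron mult.assoc)
  also have "\<dots> = (A \<otimes>\<^sub>m (B \<otimes>\<^sub>m C)) $$ (a, b)"
    using a b div_mod_less_times[OF a] div_mod_less_times[OF b] by (simp add: index_kron split div)
  finally show "((A \<otimes>\<^sub>m B) \<otimes>\<^sub>m C) $$ (a, b) = (A \<otimes>\<^sub>m (B \<otimes>\<^sub>m C)) $$ (a, b)" .
qed (simp_all add: mult.assoc)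

lemma sum_div_mod:
  fixes m n :: nat
  shows "(\<Sum>s<m * n. f (s div n) (s mod n)) = (\<Sum>u<m. \<Sum>v<n. f u v)"
proof -
  have "(\<Sum>u<m. \<Sum>v<n. f u v) = (\<Sum>(u, v)\<in>{..<m} \<times> {..<n}. f u v)"
    by (simp add: sum.cartesian_product)
  also have "\<dots> = (\<Sum>s<m * n. f (s div n) (s mod n))"
  proof (rule sum.reindex_bij_witness[of _ "\<lambda>s. (s div n, s mod n)" "\<lambda>(u, v). u * n + v"])
    fix p assume "p \<in> {..<m} \<times> {..<n}"
    then obtain u v where p: "p = (u, v)" "u < m" "v < n" by auto
    have "u * n + v < Suc u * n" using p by simp
    also have "\<dots> \<le> m * n" using p by (intro mult_right_mono) auto
    finally show "(case p of (u, v) \<Rightarrow> u * n + v) \<in> {..<m * n}" using p by simp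
  qed (auto dest: div_mod_less_times)
  finally show ?thesis ..
qed

text \<open>An index into a product space is a pair of indices into the factors, so the sum in a matrix
  product of Kronecker products is the product of two sums.\<close>

lemma kron_mult:
  assumes "A \<in> carrier_mat m n" "C \<in> carrier_mat n l" "B \<in> carrier_mat p q" "D \<in> carrier_mat q r"
  shows "(A \<otimes>\<^sub>m B) * (C \<otimes>\<^sub>m D) = (A * C) \<otimes>\<^sub>m (B * D)"
proof (rule eq_matI)
  fix a b
  assume "a < dim_row ((A * C) \<otimes>\<^sub>m (B * D))" and "b < dim_col ((A * C) \<otimes>\<^sub>m (B * D))"
  with assms have a: "a < m * p" and b: "b < l * r" by auto
  note ab = div_mod_less_times[OF a] div_mod_less_times[OF b]
  have "((A \<otimes>\<^sub>m B) * (C \<otimes>\<^sub>m D)) $$ (a, b) = (\<Sum>s<n * q. (A \<otimes>\<^sub>m B) $$ (a, s) * (C \<otimes>\<^sub>m D) $$ (s, b))"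
    using assms a b by (auto simp: scalar_prod_def lessThan_atLeast0)
  also have "\<dots> = (\<Sum>s<n * q. (A $$ (a div p, s div q) * C $$ (s div q, b div r)) *
      (B $$ (a mod p, s mod q) * D $$ (s mod q, b mod r)))"
    using assms a b by (intro sum.cong) (auto simp: index_kron)
  also have "\<dots> = (\<Sum>u<n. A $$ (a div p, u) * C $$ (u, b div r)) *
      (\<Sum>v<q. B $$ (a mod p, v) * D $$ (v, b mod r))"
    by (subst sum_div_mod) (simp add: sum_product)
  also have "\<dots> = ((A * C) \<otimes>\<^sub>m (B * D)) $$ (a, b)"
    using assms a b ab by (auto simp: index_kron scalar_prod_def lessThan_atLeast0)
  finally show "((A \<otimes>\<^sub>m B) * (C \<otimes>\<^sub>m D)) $$ (a, b) = ((A * C) \<otimes>\<^sub>m (B * D)) $$ (a, b)" .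
qed (use assms in auto)

lemma transpose_kron:
  "transpose_mat (A \<otimes>\<^sub>m B) = transpose_mat A \<otimes>\<^sub>m transpose_mat B"
  by (rule eq_matI) (auto simp: index_kron div_mod_less_times)

lemma kron_one: "1\<^sub>m m \<otimes>\<^sub>m 1\<^sub>m n = 1\<^sub>m (m * n)"
proof (rule eq_matI)
  fix a b
  assume "a < dim_row (1\<^sub>m (m * n) :: real mat)" and "b < dim_col (1\<^sub>m (m * n) :: real mat)"
  then have a: "a < m * n" and b: "b < m * n" by simp_all
  note ab = div_mod_less_times[OF a] div_mod_less_times[OF b]
  have "a = b \<longleftrightarrow> a div n = b div n \<and> a mod n = b mod n"
    by (metis div_mult_mod_eq)
  with a b ab show "(1\<^sub>m m \<otimes>\<^sub>m 1\<^sub>m n) $$ (a, b) = (1\<^sub>m (m * n) :: real mat) $$ (a, b)"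
    by (auto simp: index_kron)
qed simp_all

lemma kron_one_left: "1\<^sub>m 1 \<otimes>\<^sub>m A = A"
  by (rule eq_matI) (auto simp: index_kron)

section \<open>Creation and annihilation operators on a chain with one more site\<close>

lemma site_carrier [simp, intro]:
  "mS \<in> carrier_mat 2 2" "mA \<in> carrier_mat 2 2" "mI \<in> carrier_mat 2 2" "mA_adj \<in> carrier_mat 2 2"
  by (simp_all add: mS_def mA_def mI_def adjoint_eq_transpose mat_of_rows_list_def
      numeral_2_eq_2)

lemma site_products:
  "mS * mS = mI" "mS * mA = mA" "mA_adj * mS = mA_adj" "transpose_mat mS = mS"
  by (rule eq_matI; auto simp: mS_def mA_def mI_def adjoint_eq_transpose mat_of_rows_list_def
      scalar_prod_def numeral_2_eq_2 less_Suc_eq)+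

lemma kron_pow_mI: "kron_pow mI n = 1\<^sub>m (2 ^ n)"
  by (induction n) (simp_all add: mI_def kron_one)

lemma kron_pow_carrier [simp, intro]:
  "A \<in> carrier_mat 2 2 \<Longrightarrow> kron_pow A n \<in> carrier_mat (2 ^ n) (2 ^ n)"
  by (induction n) auto

lemma annihilation_carrier [simp, intro]:
  assumes "1 \<le> i" "i \<le> n"
  shows "annihilation n i \<in> carrier_mat (2 ^ n) (2 ^ n)"
proof -
  have "2 ^ (i - 1) * (2 * 2 ^ (n - i)) = (2 ^ n :: nat)"
    unfolding power_Suc[symmetric] power_add[symmetric] using assms by simp
  moreover have "annihilation n i \<in> carrier_mat (2 ^ (i - 1) * (2 * 2 ^ (n - i))) (2 ^ (i - 1) * (2 * 2 ^ (n - i)))"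
    unfolding annihilation_def by (intro kron_carrier kron_pow_carrier site_carrier)
  ultimately show ?thesis by simp
qed

lemma annihilation_first: "annihilation (Suc n) 1 = mA \<otimes>\<^sub>m 1\<^sub>m (2 ^ n)"
  by (simp add: annihilation_def kron_one_left[unfolded One_nat_def] kron_pow_mI)

lemma annihilation_later:
  "1 \<le> i \<Longrightarrow> annihilation (Suc n) (Suc i) = mS \<otimes>\<^sub>m annihilation n i"
  by (cases i) (simp_all add: annihilation_def kron_assoc)

lemma creation_eq: "creation n i = transpose_mat (annihilation n i)"
  by (simp add: creation_def adjoint_eq_transpose)

lemma creation_carrier [simp, intro]:
  "1 \<le> i \<Longrightarrow> i \<le> n \<Longrightarrow> creation n i \<in> carrier_mat (2 ^ n) (2 ^ n)"
  by (simp add: creation_eq)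

lemma creation_first: "creation (Suc n) 1 = mA_adj \<otimes>\<^sub>m 1\<^sub>m (2 ^ n)"
  by (simp only: creation_eq annihilation_first transpose_kron adjoint_eq_transpose transpose_one)

lemma creation_later:
  "1 \<le> i \<Longrightarrow> creation (Suc n) (Suc i) = mS \<otimes>\<^sub>m creation n i"
  by (simp add: creation_eq annihilation_later transpose_kron site_products)

text \<open>The sign matrix on the new site squares to the identity and is absorbed by
  \<^term>\<open>mA\<close> and \<^term>\<open>mA_adj\<close>; this is the whole effect of the Jordan-Wigner strings.\<close>

lemma creation_annihilation_Suc:
  assumes "1 \<le> i" "i \<le> n" "1 \<le> j" "j \<le> n"
  shows "creation (Suc n) (Suc i) * annihilation (Suc n) (Suc j) = mI \<otimes>\<^sub>m (creation n i * annihilation n j)"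
    and "creation (Suc n) 1 * annihilation (Suc n) (Suc j) = mA_adj \<otimes>\<^sub>m annihilation n j"
    and "creation (Suc n) (Suc i) * annihilation (Suc n) 1 = mA \<otimes>\<^sub>m creation n i"
    and "creation (Suc n) 1 * annihilation (Suc n) 1 = (mA_adj * mA) \<otimes>\<^sub>m 1\<^sub>m (2 ^ n)"
proof -
  note c = creation_carrier[OF assms(1,2)] and a = annihilation_carrier[OF assms(3,4)]
  note s = site_carrier
  note rules = creation_first creation_later[OF assms(1)] annihilation_first annihilation_later[OF assms(3)]
  show "creation (Suc n) (Suc i) * annihilation (Suc n) (Suc j) = mI \<otimes>\<^sub>m (creation n i * annihilation n j)"
    unfolding rules using kron_mult[OF s(1) s(1) c a] by (simp add: site_products)
  show "creation (Suc n) 1 * annihilation (Suc n) (Suc j) = mA_adj \<otimes>\<^sub>m annihilation n j"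
    unfolding rules using kron_mult[OF s(4) s(1) one_carrier_mat a] a by (simp add: site_products)
  show "creation (Suc n) (Suc i) * annihilation (Suc n) 1 = mA \<otimes>\<^sub>m creation n i"
    unfolding rules using kron_mult[OF s(1) s(2) c one_carrier_mat] c by (simp add: site_products)
  show "creation (Suc n) 1 * annihilation (Suc n) 1 = (mA_adj * mA) \<otimes>\<^sub>m 1\<^sub>m (2 ^ n)"
    unfolding rules using kron_mult[OF s(4) s(2) one_carrier_mat one_carrier_mat] by simp
qed

section \<open>The action of an array on a column of operators\<close>

text \<open>The product of the real matrix with entries \<^term>\<open>\<phi> (M $$ (j, j'))\<close> and the vector
  \<^term>\<open>x\<close>. For \<^term>\<open>\<phi>\<close> the evaluation at a fixed position, this is what a core does to one
  entry of the operators to its right; for \<^term>\<open>\<phi> = id\<close> it is the ordinary product with a real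
  matrix.\<close>

definition array_apply :: "('a \<Rightarrow> real) \<Rightarrow> 'a mat \<Rightarrow> (nat \<Rightarrow> real) \<Rightarrow> nat \<Rightarrow> real" where
  "array_apply \<phi> M x j = (\<Sum>j'<dim_col M. \<phi> (M $$ (j, j')) * x j')"

lemma dim_hcat [simp]:
  "dim_row (hcat A B) = dim_row A" "dim_col (hcat A B) = dim_col A + dim_col B"
  by (simp_all add: hcat_def)

lemma dim_vcat [simp]:
  "dim_row (vcat A B) = dim_row A + dim_row B" "dim_col (vcat A B) = dim_col A"
  by (simp_all add: vcat_def)

lemma dim_block_pieces [simp]:
  "dim_row (single a) = 1" "dim_col (single a) = 1"
  "dim_row (zero_core r r') = r" "dim_col (zero_core r r') = r'"
  "dim_row (S_core r) = r" "dim_col (S_core r) = r"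
  "dim_row (W \<up> B) = dim_row W" "dim_col (W \<up> B) = dim_col W"
  by (simp_all add: single_def zero_core_def S_core_def uparrow_core_def)

lemma dim_W [simp]:
  "dim_row (W1 T k) = k - 1" "dim_col (W1 T k) = 1"
  "dim_row (W2 T k) = k - 1" "dim_col (W2 T k) = 1"
  "dim_row (W3 K T k) = 1" "dim_col (W3 K T k) = K - k"
  "dim_row (W4 K T k) = 1" "dim_col (W4 K T k) = K - k"
  "dim_row (W5 K T) = K div 2" "dim_col (W5 K T) = K div 2"
  "dim_row (W6 K T) = K div 2" "dim_col (W6 K T) = K div 2"
  by (simp_all add: W1_def W2_def W3_def W4_def W5_def W6_def)

lemma sum_lessThan_add:
  fixes f :: "nat \<Rightarrow> 'a :: comm_monoid_add"
  shows "(\<Sum>i<m + n. f i) = (\<Sum>i<m. f i) + (\<Sum>i<n. f (i + m))"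
proof -
  have "(\<Sum>i<m + n. f i) = sum f {0..<m} + sum f {m..<m + n}"
    by (simp add: lessThan_atLeast0 sum.atLeastLessThan_concat)
  also have "sum f {m..<m + n} = (\<Sum>i<n. f (i + m))"
    using sum.shift_bounds_nat_ivl[of f 0 m n] by (simp add: lessThan_atLeast0 add.commute)
  finally show ?thesis by (simp add: lessThan_atLeast0)
qed

text \<open>The action is computed block by block: a block column contributes its own segment of the vector,
  shifted to start at index 0, and a block row produces its own segment of the result. With the rules
  for the individual blocks this reduces every core, of whatever size, to an explicit case
  distinction on the row.\<close>

lemma array_apply_hcat:
  assumes "j < dim_row A"
  shows "array_apply \<phi> (hcat A B) x j =
    array_apply \<phi> A x j + array_apply \<phi> B (\<lambda>s. x (s + dim_col A)) j"
proof -
  have "hcat A B $$ (j, i) = A $$ (j, i)" if "i < dim_col A" for i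
    using assms that by (simp add: hcat_def)
  moreover have "hcat A B $$ (j, i + dim_col A) = B $$ (j, i)" if "i < dim_col B" for i
    using assms that by (simp add: hcat_def)
  ultimately show ?thesis
    by (simp add: array_apply_def sum_lessThan_add)
qed

lemma array_apply_vcat:
  assumes "dim_col B = dim_col A" "j < dim_row A + dim_row B"
  shows "array_apply \<phi> (vcat A B) x j =
    (if j < dim_row A then array_apply \<phi> A x j else array_apply \<phi> B x (j - dim_row A))"
  using assms by (auto simp: array_apply_def vcat_def intro!: sum.cong)

lemma array_apply_single: "j = 0 \<Longrightarrow> array_apply \<phi> (single a) x j = \<phi> a * x 0"
  by (simp add: array_apply_def single_def)

lemma array_apply_zero_core:
  "j < r \<Longrightarrow> \<phi> (0\<^sub>m 2 2) = 0 \<Longrightarrow> array_apply \<phi> (zero_core r r') x j = 0"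
  by (simp add: array_apply_def zero_core_def)

lemma array_apply_zero_mat:
  "j < r \<Longrightarrow> \<phi> 0 = 0 \<Longrightarrow> array_apply \<phi> (0\<^sub>m r r') x j = 0"
  by (simp add: array_apply_def)

lemma sum_delta_times:
  "(\<Sum>i<(n::nat). (if i = j then c i else 0) * x i) = (if j < n then c j * x j else (0::real))"
  by (simp add: if_distrib[of "\<lambda>u. u * _"] sum.delta' cong: if_cong)

lemma array_apply_S_core:
  assumes "j < r" "\<phi> (0\<^sub>m 2 2) = 0"
  shows "array_apply \<phi> (S_core r) x j = \<phi> mS * x j"
proof -
  have "array_apply \<phi> (S_core r) x j = (\<Sum>i<r. (if i = j then \<phi> mS else 0) * x i)"
    using assms by (auto simp: array_apply_def S_core_def intro!: sum.cong)
  then show ?thesis using assms by (simp add: sum_delta_times)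
qed

lemma array_apply_uparrow:
  assumes "j < dim_row W" "\<And>w. \<phi> (w \<cdot>\<^sub>m B) = w * \<phi> B"
  shows "array_apply \<phi> (W \<up> B) x j = \<phi> B * (\<Sum>i<dim_col W. W $$ (j, i) * x i)"
  using assms by (simp add: array_apply_def uparrow_core_def sum_distrib_left algebra_simps)

definition site_entries :: "core \<Rightarrow> bool" where
  "site_entries M \<longleftrightarrow> (\<forall>j<dim_row M. \<forall>j'<dim_col M. M $$ (j, j') \<in> carrier_mat 2 2)"

lemma is_core_iff:
  "is_core r r' M \<longleftrightarrow> 0 < r \<and> 0 < r' \<and> dim_row M = r \<and> dim_col M = r' \<and> site_entries M"
  by (auto simp: is_core_def site_entries_def)

lemma site_entries_hcat:
  "dim_row B = dim_row A \<Longrightarrow> site_entries A \<Longrightarrow> site_entries B \<Longrightarrow> site_entries (hcat A B)"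
  by (simp add: site_entries_def hcat_def)

lemma site_entries_vcat:
  "dim_col B = dim_col A \<Longrightarrow> site_entries A \<Longrightarrow> site_entries B \<Longrightarrow> site_entries (vcat A B)"
  by (simp add: site_entries_def vcat_def)

lemma site_entries_pieces:
  "B \<in> carrier_mat 2 2 \<Longrightarrow> site_entries (single B)"
  "site_entries (zero_core r r')"
  "site_entries (S_core r)"
  "B \<in> carrier_mat 2 2 \<Longrightarrow> site_entries (W \<up> B)"
  by (simp_all add: site_entries_def single_def zero_core_def S_core_def uparrow_core_def)

lemma dim_core_mult [simp]:
  "dim_row (core_mult M G) = dim_row M" "dim_col (core_mult M G) = dim_col G"
  by (simp_all add: core_mult_def)

lemma core_mult_entry:
  assumes "site_entries M" "j < dim_row M" "j'' < dim_col G"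
  shows "core_mult M G $$ (j, j'') =
    mat 2 2 (\<lambda>(a, b). \<Sum>j'<dim_col M. G $$ (j', j'') * M $$ (j, j') $$ (a, b))"
proof -
  have M: "M $$ (j, j') \<in> carrier_mat 2 2" if "j' < dim_col M" for j'
    using assms that by (simp add: site_entries_def)
  have "core_mult M G $$ (j, j'') = mat_sum 2 2 (\<lambda>j'. G $$ (j', j'') \<cdot>\<^sub>m M $$ (j, j')) {..<dim_col M}"
    using assms by (simp add: core_mult_def)
  also have "\<dots> = mat 2 2 (\<lambda>(a, b). \<Sum>j'<dim_col M. (G $$ (j', j'') \<cdot>\<^sub>m M $$ (j, j')) $$ (a, b))"
    using M by (intro mat_sum_eq) auto
  also have "\<dots> = mat 2 2 (\<lambda>(a, b). \<Sum>j'<dim_col M. G $$ (j', j'') * M $$ (j, j') $$ (a, b))"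
    using carrier_matD[OF M] by (intro eq_matI) auto
  finally show ?thesis .
qed

lemma site_entries_core_mult:
  "site_entries M \<Longrightarrow> site_entries (core_mult M G)"
  by (simp add: site_entries_def[of "core_mult M G"] core_mult_entry)

lemma array_apply_core_mult:
  assumes "site_entries M" "j < dim_row M" "\<alpha> < 2" "\<beta> < 2"
  shows "array_apply (\<lambda>B. B $$ (\<alpha>, \<beta>)) (core_mult M G) x j =
    array_apply (\<lambda>B. B $$ (\<alpha>, \<beta>)) M (array_apply id G x) j"
proof -
  have "array_apply (\<lambda>B. B $$ (\<alpha>, \<beta>)) (core_mult M G) x j =
      (\<Sum>j''<dim_col G. (\<Sum>j'<dim_col M. G $$ (j', j'') * M $$ (j, j') $$ (\<alpha>, \<beta>)) * x j'')"
    using assms by (simp add: array_apply_def core_mult_entry)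
  also have "\<dots> = (\<Sum>j'<dim_col M. \<Sum>j''<dim_col G. M $$ (j, j') $$ (\<alpha>, \<beta>) * (G $$ (j', j'') * x j''))"
    by (subst sum.swap) (simp add: sum_distrib_right sum_distrib_left algebra_simps)
  finally show ?thesis by (simp add: array_apply_def sum_distrib_left)
qed

section \<open>Evaluating a product from the right\<close>

definition column :: "nat \<Rightarrow> (nat \<Rightarrow> 'a) \<Rightarrow> 'a mat" where
  "column r V = mat r 1 (\<lambda>(j, _). V j)"

text \<open>A suffix of the product is a column of operators on the remaining sites. In the splitting
  of an index into its leading and its remaining binary digits, one more core acts on that column
  as a real matrix, whose entries are those of the core at the leading digits.\<close>

definition core_step :: "nat \<Rightarrow> core \<Rightarrow> (nat \<Rightarrow> real mat) \<Rightarrow> nat \<Rightarrow> real mat \<Rightarrow> bool" where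
  "core_step N M V j X \<longleftrightarrow> X \<in> carrier_mat (2 * N) (2 * N) \<and>
     (\<forall>\<alpha><2. \<forall>\<beta><2. \<forall>a<N. \<forall>b<N. X $$ (\<alpha> * N + a, \<beta> * N + b) =
       array_apply (\<lambda>B. B $$ (\<alpha>, \<beta>)) M (\<lambda>j'. V j' $$ (a, b)) j)"

lemma core_step_entry:
  assumes "core_step N M V j X" "a < 2 * N" "b < 2 * N"
  shows "X $$ (a, b) = array_apply (\<lambda>B. B $$ (a div N, b div N)) M (\<lambda>j'. V j' $$ (a mod N, b mod N)) j"
  using assms(1)[unfolded core_step_def] div_mod_less_times[OF assms(2)] div_mod_less_times[OF assms(3)]
  by (metis div_mult_mod_eq)

lemma strong_kron_column:
  assumes M: "is_core r r' M"
    and V: "\<And>j'. j' < r' \<Longrightarrow> V j' \<in> carrier_mat N N"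
    and step: "\<And>j. j < r \<Longrightarrow> core_step N M V j (X j)"
  shows "M \<Join> column r' V = column r X"
proof (rule eq_matI)
  fix j c assume "j < dim_row (column r X)" "c < dim_col (column r X)"
  then have j: "j < r" and c: "c = 0" by (simp_all add: column_def)
  have entries: "M $$ (j, j') \<in> carrier_mat 2 2" if "j' < r'" for j'
    using M j that by (simp add: is_core_def)
  have dims: "dim_row M = r" "dim_col M = r'" "dim_row (M $$ (0, 0)) = 2" "dim_col (M $$ (0, 0)) = 2"
    "0 < r'" "dim_row (V 0) = N" "dim_col (V 0) = N"
    using M V[of 0] by (auto simp: is_core_def)
  have "(M \<Join> column r' V) $$ (j, c) = mat_sum (2 * N) (2 * N) (\<lambda>j'. M $$ (j, j') \<otimes>\<^sub>m column r' V $$ (j', 0)) {..<r'}"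
    using j c dims by (simp add: strong_kron_def column_def)
  also have "\<dots> = mat (2 * N) (2 * N) (\<lambda>(a, b). \<Sum>j'<r'. (M $$ (j, j') \<otimes>\<^sub>m column r' V $$ (j', 0)) $$ (a, b))"
    using entries V by (intro mat_sum_eq) (auto simp: column_def)
  also have "\<dots> = X j"
  proof (rule eq_matI)
    fix a b assume "a < dim_row (X j)" "b < dim_col (X j)"
    with step[OF j] have ab: "a < 2 * N" "b < 2 * N" by (auto simp: core_step_def)
    have "(\<Sum>j'<r'. (M $$ (j, j') \<otimes>\<^sub>m column r' V $$ (j', 0)) $$ (a, b)) =
        (\<Sum>j'<r'. M $$ (j, j') $$ (a div N, b div N) * V j' $$ (a mod N, b mod N))"
    proof (rule sum.cong)
      fix j' assume "j' \<in> {..<r'}"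
      then show "(M $$ (j, j') \<otimes>\<^sub>m column r' V $$ (j', 0)) $$ (a, b) =
          M $$ (j, j') $$ (a div N, b div N) * V j' $$ (a mod N, b mod N)"
        using ab entries[of j'] V[of j'] by (auto simp: column_def index_kron)
    qed simp
    then show "mat (2 * N) (2 * N) (\<lambda>(a, b). \<Sum>j'<r'. (M $$ (j, j') \<otimes>\<^sub>m column r' V $$ (j', 0)) $$ (a, b)) $$ (a, b) = X j $$ (a, b)"
      using ab core_step_entry[OF step[OF j] ab] dims by (simp add: array_apply_def)
  qed (use step[OF j] in \<open>auto simp: core_step_def\<close>)
  finally show "(M \<Join> column r' V) $$ (j, c) = column r X $$ (j, c)"
    using j c by (simp add: column_def)
qed (use M in \<open>auto simp: strong_kron_def column_def is_core_def\<close>)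

text \<open>The operator \<^term>\<open>1\<^sub>m 1\<close> on no sites is neutral for the Kronecker product.\<close>

lemma strong_kron_unit:
  assumes "is_core r 1 M"
  shows "M \<Join> column 1 (\<lambda>_. 1\<^sub>m 1) = M"
proof -
  have "core_step 1 M (\<lambda>_. 1\<^sub>m 1) j (M $$ (j, 0))" if "j < r" for j
    using assms that by (auto simp: core_step_def array_apply_def is_core_def)
  then have "M \<Join> column 1 (\<lambda>_. 1\<^sub>m 1) = column r (\<lambda>j. M $$ (j, 0))"
    by (intro strong_kron_column[OF assms, where N = 1]) auto
  also have "\<dots> = M" using assms by (auto simp: column_def is_core_def intro!: eq_matI)
  finally show ?thesis .
qed

lemma mpo_prod_Cons: "Ms \<noteq> [] \<Longrightarrow> mpo_prod (M # Ms) = M \<Join> mpo_prod Ms"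
  by (cases Ms) auto

text \<open>So a product is evaluated by guessing the columns that its suffixes produce and checking
  one core at a time. The unit column stands for the empty suffix.\<close>

lemma mpo_prod_eq_column:
  assumes core: "\<And>k. k \<in> {1..K} \<Longrightarrow> is_core (r (k - 1)) (r k) (M k)" and "r K = 1"
    and start: "V (Suc K) 0 = 1\<^sub>m 1"
    and step: "\<And>k j. k \<in> {1..K} \<Longrightarrow> j < r (k - 1) \<Longrightarrow> core_step (2 ^ (K - k)) (M k) (V (Suc k)) j (V k j)"
    and k: "k \<in> {1..K}"
  shows "mpo_prod (map M [k..<Suc K]) = column (r (k - 1)) (V k)"
proof -
  have "k \<le> K" using k by simp
  then show ?thesis using k
  proof (induction k rule: inc_induct)
    case base
    have "mpo_prod (map M [K..<Suc K]) = M K \<Join> column 1 (\<lambda>_. 1\<^sub>m 1)"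
      using strong_kron_unit[of "r (K - 1)" "M K"] core[OF base] assms(2) by simp
    also have "column 1 (\<lambda>_. 1\<^sub>m 1) = column (r K) (V (Suc K))"
      by (rule eq_matI) (auto simp: column_def start assms(2))
    also have "M K \<Join> \<dots> = column (r (K - 1)) (V K)"
      by (rule strong_kron_column[OF core[OF base] _ step[OF base]]) (simp_all add: start assms(2))
    finally show ?case .
  next
    case (step n)
    then have n: "n \<in> {1..K}" "Suc n \<in> {1..K}" and "n < K" by auto
    have "[n..<Suc K] = n # [Suc n..<Suc K]" using n by (intro upt_conv_Cons) simp
    then have "mpo_prod (map M [n..<Suc K]) = M n \<Join> mpo_prod (map M [Suc n..<Suc K])"
      using \<open>n < K\<close> by (simp add: mpo_prod_Cons del: upt_Suc)
    also have "\<dots> = M n \<Join> column (r n) (V (Suc n))"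
      using step.IH n by simp
    also have "\<dots> = column (r (n - 1)) (V n)"
    proof (rule strong_kron_column[OF core[OF n(1)] _ assms(4)[OF n(1)]])
      fix j assume "j < r n"
      with assms(4)[OF n(2), of j] have "V (Suc n) j \<in> carrier_mat (2 * 2 ^ (K - Suc n)) (2 * 2 ^ (K - Suc n))"
        by (simp add: core_step_def)
      moreover have "2 * 2 ^ (K - Suc n) = (2 ^ (K - n) :: nat)"
        using \<open>n < K\<close> by (simp flip: power_Suc add: Suc_diff_Suc)
      ultimately show "V (Suc n) j \<in> carrier_mat (2 ^ (K - n)) (2 ^ (K - n))" by simp
    qed
    finally show ?case .
  qed
qed

section \<open>Operators on the sites from k to K\<close>

text \<open>All operators in this part live on the last \<^term>\<open>Suc K - k\<close> sites, but keep the site numbers of the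
  full chain, so that the coefficients need no shift. For \<^term>\<open>k = Suc K\<close> no site is left and the
  operators are 1 by 1 matrices.\<close>

definition ann_tail :: "nat \<Rightarrow> nat \<Rightarrow> nat \<Rightarrow> real mat" where
  "ann_tail K k j = annihilation (Suc K - k) (Suc j - k)"

definition cre_tail :: "nat \<Rightarrow> nat \<Rightarrow> nat \<Rightarrow> real mat" where
  "cre_tail K k j = creation (Suc K - k) (Suc j - k)"

definition ann_sum :: "nat \<Rightarrow> (nat \<Rightarrow> real) \<Rightarrow> nat \<Rightarrow> real mat" where
  "ann_sum K c k = mat (2 ^ (Suc K - k)) (2 ^ (Suc K - k))
     (\<lambda>ab. \<Sum>j=k..K. c j * ann_tail K k j $$ ab)"

definition cre_sum :: "nat \<Rightarrow> (nat \<Rightarrow> real) \<Rightarrow> nat \<Rightarrow> real mat" where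
  "cre_sum K c k = mat (2 ^ (Suc K - k)) (2 ^ (Suc K - k))
     (\<lambda>ab. \<Sum>j=k..K. c j * cre_tail K k j $$ ab)"

definition op_tail :: "nat \<Rightarrow> (nat \<Rightarrow> nat \<Rightarrow> real) \<Rightarrow> nat \<Rightarrow> real mat" where
  "op_tail K t k = mat (2 ^ (Suc K - k)) (2 ^ (Suc K - k))
     (\<lambda>ab. \<Sum>i=k..K. \<Sum>j=k..K. t i j * (cre_tail K k i * ann_tail K k j) $$ ab)"

lemma tail_carrier [simp]:
  "k \<le> j \<Longrightarrow> j \<le> K \<Longrightarrow> ann_tail K k j \<in> carrier_mat (2 ^ (Suc K - k)) (2 ^ (Suc K - k))"
  "k \<le> j \<Longrightarrow> j \<le> K \<Longrightarrow> cre_tail K k j \<in> carrier_mat (2 ^ (Suc K - k)) (2 ^ (Suc K - k))"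
  "ann_sum K c k \<in> carrier_mat (2 ^ (Suc K - k)) (2 ^ (Suc K - k))"
  "cre_sum K c k \<in> carrier_mat (2 ^ (Suc K - k)) (2 ^ (Suc K - k))"
  "op_tail K t k \<in> carrier_mat (2 ^ (Suc K - k)) (2 ^ (Suc K - k))"
  unfolding ann_tail_def cre_tail_def ann_sum_def cre_sum_def op_tail_def
  by (simp_all add: annihilation_carrier creation_carrier)

lemma op_tail_1: "op_tail K (entry T) 1 = one_particle_op K T"
proof -
  have "one_particle_op K T = mat (2 ^ K) (2 ^ K)
      (\<lambda>(a, b). \<Sum>p\<in>{1..K} \<times> {1..K}. (case p of (i, j) \<Rightarrow>
        entry T i j \<cdot>\<^sub>m (creation K i * annihilation K j)) $$ (a, b))"
    unfolding one_particle_op_def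
    by (intro mat_sum_eq) (auto intro!: smult_carrier_mat mult_carrier_mat[of _ _ "2 ^ K"]
        creation_carrier annihilation_carrier)
  also have "\<dots> = op_tail K (entry T) 1"
  proof (rule eq_matI)
    fix a b assume ab: "a < dim_row (op_tail K (entry T) 1)" "b < dim_col (op_tail K (entry T) 1)"
    have "(\<Sum>p\<in>{1..K} \<times> {1..K}. (case p of (i, j) \<Rightarrow>
        entry T i j \<cdot>\<^sub>m (creation K i * annihilation K j)) $$ (a, b)) =
      (\<Sum>p\<in>{1..K} \<times> {1..K}. (case p of (i, j) \<Rightarrow>
        entry T i j * (creation K i * annihilation K j) $$ (a, b)))"
    proof (rule sum.cong)
      fix p assume "p \<in> {1..K} \<times> {1..K}"
      then obtain i j where p: "p = (i, j)" "1 \<le> i" "i \<le> K" "1 \<le> j" "j \<le> K" by auto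
      then have "dim_row (creation K i) = 2 ^ K" "dim_col (annihilation K j) = 2 ^ K"
        using creation_carrier annihilation_carrier by blast+
      then show "(case p of (i, j) \<Rightarrow>
          entry T i j \<cdot>\<^sub>m (creation K i * annihilation K j)) $$ (a, b) =
        (case p of (i, j) \<Rightarrow> entry T i j * (creation K i * annihilation K j) $$ (a, b))"
        using ab p by (auto simp: op_tail_def)
    qed simp
    then show "mat (2 ^ K) (2 ^ K) (\<lambda>(a, b). \<Sum>p\<in>{1..K} \<times> {1..K}. (case p of (i, j) \<Rightarrow>
        entry T i j \<cdot>\<^sub>m (creation K i * annihilation K j)) $$ (a, b)) $$ (a, b) =
      op_tail K (entry T) 1 $$ (a, b)"
      using ab by (simp add: op_tail_def sum.cartesian_product ann_tail_def cre_tail_def)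
  qed (simp_all add: op_tail_def)
  finally show ?thesis ..
qed

lemma kron_entry:
  assumes "B \<in> carrier_mat 2 2" "X \<in> carrier_mat N N" "\<alpha> < 2" "\<beta> < 2" "a < N" "b < N"
  shows "(B \<otimes>\<^sub>m X) $$ (\<alpha> * N + a, \<beta> * N + b) = B $$ (\<alpha>, \<beta>) * X $$ (a, b)"
proof -
  have "\<gamma> * N + c < 2 * N" if "\<gamma> < 2" "c < N" for \<gamma> c
    using that by (auto simp: less_2_cases_iff)
  with assms show ?thesis by (auto simp: index_kron)
qed

text \<open>The following recursions split off the site \<^term>\<open>k\<close>. The rows and columns of an operator on the
  sites from \<^term>\<open>k\<close> on are written as a leading digit \<^term>\<open>\<alpha>\<close> or \<^term>\<open>\<beta>\<close>, which belongs to the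
  site \<^term>\<open>k\<close>, in front of an index \<^term>\<open>a\<close> or \<^term>\<open>b\<close> for the remaining sites. Kronecker
  products then become products of numbers, and the recursions have the form of one row of a core
  applied to a column.\<close>

context
  fixes K k N \<alpha> \<beta> a b :: nat
  assumes k: "1 \<le> k" "k \<le> K" and N: "N = 2 ^ (K - k)"
    and digits: "\<alpha> < 2" "\<beta> < 2" "a < N" "b < N"
begin

lemma double_N: "2 ^ (Suc K - k) = 2 * N"
  using k by (simp add: N Suc_diff_le)

lemma index_less: "\<alpha> * N + a < 2 * N" "\<beta> * N + b < 2 * N"
  using digits by (auto simp: less_2_cases_iff)

lemma one_step:
  "(1\<^sub>m (2 ^ (Suc K - k)) :: real mat) $$ (\<alpha> * N + a, \<beta> * N + b) =
    mI $$ (\<alpha>, \<beta>) * 1\<^sub>m (2 ^ (K - k)) $$ (a, b)"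
  using kron_entry[OF site_carrier(3) one_carrier_mat digits]
  by (simp add: double_N mI_def kron_one N)

lemma tail_later:
  assumes "k < j"
  shows "ann_tail K k j = mS \<otimes>\<^sub>m ann_tail K (Suc k) j" "cre_tail K k j = mS \<otimes>\<^sub>m cre_tail K (Suc k) j"
  using annihilation_later[of "j - k" "K - k"] creation_later[of "j - k" "K - k"] assms k
  by (simp_all add: ann_tail_def cre_tail_def Suc_diff_le)

lemma tail_first:
  "ann_tail K k k = mA \<otimes>\<^sub>m 1\<^sub>m N" "cre_tail K k k = mA_adj \<otimes>\<^sub>m 1\<^sub>m N"
  using annihilation_first[of "K - k"] creation_first[of "K - k"] k
  by (simp_all add: ann_tail_def cre_tail_def Suc_diff_le N)

lemma ann_sum_step:
  "ann_sum K c k $$ (\<alpha> * N + a, \<beta> * N + b) =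
    mS $$ (\<alpha>, \<beta>) * ann_sum K c (Suc k) $$ (a, b) + c k * mA $$ (\<alpha>, \<beta>) * 1\<^sub>m (2 ^ (K - k)) $$ (a, b)"
proof -
  have "ann_sum K c k $$ (\<alpha> * N + a, \<beta> * N + b) =
      c k * ann_tail K k k $$ (\<alpha> * N + a, \<beta> * N + b) +
      (\<Sum>j=Suc k..K. c j * ann_tail K k j $$ (\<alpha> * N + a, \<beta> * N + b))"
    using k index_less by (simp add: ann_sum_def double_N sum.atLeast_Suc_atMost)
  also have "(\<Sum>j=Suc k..K. c j * ann_tail K k j $$ (\<alpha> * N + a, \<beta> * N + b)) =
      (\<Sum>j=Suc k..K. mS $$ (\<alpha>, \<beta>) * (c j * ann_tail K (Suc k) j $$ (a, b)))"
    using kron_entry[OF site_carrier(1) _ digits] tail_carrier(1)[of "Suc k" _ K]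
    by (intro sum.cong) (simp_all add: tail_later N)
  also have "\<dots> = mS $$ (\<alpha>, \<beta>) * ann_sum K c (Suc k) $$ (a, b)"
    using digits by (simp add: ann_sum_def N sum_distrib_left)
  finally show ?thesis
    using kron_entry[OF site_carrier(2) one_carrier_mat digits] by (simp add: tail_first N)
qed

lemma cre_sum_step:
  "cre_sum K c k $$ (\<alpha> * N + a, \<beta> * N + b) =
    mS $$ (\<alpha>, \<beta>) * cre_sum K c (Suc k) $$ (a, b) + c k * mA_adj $$ (\<alpha>, \<beta>) * 1\<^sub>m (2 ^ (K - k)) $$ (a, b)"
proof -
  have "cre_sum K c k $$ (\<alpha> * N + a, \<beta> * N + b) =
      c k * cre_tail K k k $$ (\<alpha> * N + a, \<beta> * N + b) +
      (\<Sum>j=Suc k..K. c j * cre_tail K k j $$ (\<alpha> * N + a, \<beta> * N + b))"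
    using k index_less by (simp add: cre_sum_def double_N sum.atLeast_Suc_atMost)
  also have "(\<Sum>j=Suc k..K. c j * cre_tail K k j $$ (\<alpha> * N + a, \<beta> * N + b)) =
      (\<Sum>j=Suc k..K. mS $$ (\<alpha>, \<beta>) * (c j * cre_tail K (Suc k) j $$ (a, b)))"
    using kron_entry[OF site_carrier(1) _ digits] tail_carrier(2)[of "Suc k" _ K]
    by (intro sum.cong) (simp_all add: tail_later N)
  also have "\<dots> = mS $$ (\<alpha>, \<beta>) * cre_sum K c (Suc k) $$ (a, b)"
    using digits by (simp add: cre_sum_def N sum_distrib_left)
  finally show ?thesis
    using kron_entry[OF site_carrier(4) one_carrier_mat digits] by (simp add: tail_first N)
qed

lemma tail_rest_carrier:
  assumes "k < j" "j \<le> K"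
  shows "ann_tail K (Suc k) j \<in> carrier_mat N N" "cre_tail K (Suc k) j \<in> carrier_mat N N"
  using assms tail_carrier(1,2)[of "Suc k" j K] by (simp_all add: N)

lemma tail_unfold:
  assumes "k < j"
  shows "ann_tail K k j = annihilation (Suc (K - k)) (Suc (j - k))"
    and "cre_tail K k j = creation (Suc (K - k)) (Suc (j - k))"
    and "ann_tail K (Suc k) j = annihilation (K - k) (j - k)"
    and "cre_tail K (Suc k) j = creation (K - k) (j - k)"
    and "ann_tail K k k = annihilation (Suc (K - k)) 1"
    and "cre_tail K k k = creation (Suc (K - k)) 1"
  using assms k by (simp_all add: ann_tail_def cre_tail_def Suc_diff_le)

lemma diff_bounds: "k < j \<Longrightarrow> j \<le> K \<Longrightarrow> 1 \<le> j - k" "k < j \<Longrightarrow> j \<le> K \<Longrightarrow> j - k \<le> K - k"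
  by simp_all

lemma product_step:
  assumes "k < i" "i \<le> K" "k < j" "j \<le> K"
  shows "(cre_tail K k i * ann_tail K k j) $$ (\<alpha> * N + a, \<beta> * N + b) =
      mI $$ (\<alpha>, \<beta>) * (cre_tail K (Suc k) i * ann_tail K (Suc k) j) $$ (a, b)"
  using diff_bounds[OF assms(1,2)] diff_bounds[OF assms(3,4)] kron_entry[OF site_carrier(3) mult_carrier_mat[OF tail_rest_carrier(2)[OF assms(1,2)]
      tail_rest_carrier(1)[OF assms(3,4)]] digits]
    creation_annihilation_Suc(1)[of "i - k" "K - k" "j - k"] assms
  by (simp add: tail_unfold[OF assms(1)] tail_unfold[OF assms(3)])

lemma product_step_mixed:
  assumes "k < j" "j \<le> K"
  shows "(cre_tail K k k * ann_tail K k j) $$ (\<alpha> * N + a, \<beta> * N + b) =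
      mA_adj $$ (\<alpha>, \<beta>) * ann_tail K (Suc k) j $$ (a, b)"
    and "(cre_tail K k j * ann_tail K k k) $$ (\<alpha> * N + a, \<beta> * N + b) =
      mA $$ (\<alpha>, \<beta>) * cre_tail K (Suc k) j $$ (a, b)"
  using diff_bounds[OF assms] kron_entry[OF site_carrier(4) tail_rest_carrier(1)[OF assms] digits]
    kron_entry[OF site_carrier(2) tail_rest_carrier(2)[OF assms] digits]
    creation_annihilation_Suc(2,3)[of "j - k" "K - k" "j - k"] assms
  by (simp_all add: tail_unfold[OF assms(1)])

lemma product_step_first:
  "(cre_tail K k k * ann_tail K k k) $$ (\<alpha> * N + a, \<beta> * N + b) =
    (mA_adj * mA) $$ (\<alpha>, \<beta>) * 1\<^sub>m (2 ^ (K - k)) $$ (a, b)"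
  using kron_mult[OF site_carrier(4) site_carrier(2) one_carrier_mat one_carrier_mat, of N]
    kron_entry[OF mult_carrier_mat[OF site_carrier(4) site_carrier(2)] one_carrier_mat digits]
  by (simp add: tail_first N)

text \<open>A term of the one-particle operator acts on the first site with both, one or none of its
  two factors.\<close>

lemma op_tail_step:
  "op_tail K t k $$ (\<alpha> * N + a, \<beta> * N + b) =
    mI $$ (\<alpha>, \<beta>) * op_tail K t (Suc k) $$ (a, b)
    + mA $$ (\<alpha>, \<beta>) * cre_sum K (\<lambda>j. t j k) (Suc k) $$ (a, b)
    + mA_adj $$ (\<alpha>, \<beta>) * ann_sum K (t k) (Suc k) $$ (a, b)
    + t k k * (mA_adj * mA) $$ (\<alpha>, \<beta>) * 1\<^sub>m (2 ^ (K - k)) $$ (a, b)"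
proof -
  define P where "P i j = t i j * (cre_tail K k i * ann_tail K k j) $$ (\<alpha> * N + a, \<beta> * N + b)" for i j
  have "op_tail K t k $$ (\<alpha> * N + a, \<beta> * N + b) = (\<Sum>i=k..K. \<Sum>j=k..K. P i j)"
    using index_less by (simp add: op_tail_def double_N P_def)
  also have "\<dots> = P k k + (\<Sum>j=Suc k..K. P k j) + ((\<Sum>i=Suc k..K. P i k) + (\<Sum>i=Suc k..K. \<Sum>j=Suc k..K. P i j))"
    using k by (simp add: sum.atLeast_Suc_atMost sum.distrib)
  also have "P k k = t k k * (mA_adj * mA) $$ (\<alpha>, \<beta>) * 1\<^sub>m (2 ^ (K - k)) $$ (a, b)"
    by (simp add: P_def product_step_first)
  also have "(\<Sum>j=Suc k..K. P k j) = (\<Sum>j=Suc k..K. mA_adj $$ (\<alpha>, \<beta>) * (t k j * ann_tail K (Suc k) j $$ (a, b)))"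
    by (intro sum.cong) (auto simp: P_def product_step_mixed)
  also have "\<dots> = mA_adj $$ (\<alpha>, \<beta>) * ann_sum K (t k) (Suc k) $$ (a, b)"
    using digits by (simp add: ann_sum_def N sum_distrib_left)
  also have "(\<Sum>i=Suc k..K. P i k) = (\<Sum>i=Suc k..K. mA $$ (\<alpha>, \<beta>) * (t i k * cre_tail K (Suc k) i $$ (a, b)))"
    by (intro sum.cong) (auto simp: P_def product_step_mixed)
  also have "\<dots> = mA $$ (\<alpha>, \<beta>) * cre_sum K (\<lambda>j. t j k) (Suc k) $$ (a, b)"
    using digits by (simp add: cre_sum_def N sum_distrib_left)
  also have "(\<Sum>i=Suc k..K. \<Sum>j=Suc k..K. P i j) =
      (\<Sum>i=Suc k..K. \<Sum>j=Suc k..K. mI $$ (\<alpha>, \<beta>) * (t i j * (cre_tail K (Suc k) i * ann_tail K (Suc k) j) $$ (a, b)))"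
    by (intro sum.cong) (auto simp: P_def product_step)
  also have "\<dots> = mI $$ (\<alpha>, \<beta>) * op_tail K t (Suc k) $$ (a, b)"
    using digits by (simp add: op_tail_def N sum_distrib_left)
  finally show ?thesis by simp
qed

end

text \<open>Without a site there is nothing to create or annihilate. These are the starting values for the
  last site.\<close>

lemma tail_empty:
  "op_tail K t (Suc K) = 0\<^sub>m 1 1" "cre_sum K c (Suc K) = 0\<^sub>m 1 1" "ann_sum K c (Suc K) = 0\<^sub>m 1 1"
  by (auto simp: op_tail_def cre_sum_def ann_sum_def intro!: eq_matI)

section \<open>The action of the cores\<close>

definition site_value :: "nat \<Rightarrow> nat \<Rightarrow> real mat \<Rightarrow> real" where
  "site_value \<alpha> \<beta> B = B $$ (\<alpha>, \<beta>)"

lemma site_value_zero: "\<alpha> < 2 \<Longrightarrow> \<beta> < 2 \<Longrightarrow> site_value \<alpha> \<beta> (0\<^sub>m 2 2) = 0"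
  by (simp add: site_value_def)

lemma site_value_smult:
  "\<alpha> < 2 \<Longrightarrow> \<beta> < 2 \<Longrightarrow> B \<in> carrier_mat 2 2 \<Longrightarrow> site_value \<alpha> \<beta> (w \<cdot>\<^sub>m B) = w * site_value \<alpha> \<beta> B"
  by (auto simp: site_value_def)

lemma number_carrier: "mA_adj * mA \<in> carrier_mat 2 2"
  by (rule mult_carrier_mat[OF site_carrier(4,2)])

lemmas site_value_simps = site_value_zero site_value_smult[OF _ _ site_carrier(2)]
  site_value_smult[OF _ _ site_carrier(4)] site_value_smult[OF _ _ number_carrier]

lemmas array_apply_blocks = array_apply_hcat array_apply_vcat array_apply_single
  array_apply_zero_core array_apply_S_core array_apply_uparrow site_value_simps

lemmas site_entries_blocks = site_entries_hcat site_entries_vcat site_entries_pieces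
  smult_carrier_mat number_carrier

text \<open>In the columns of the core, the vector has index 0 for the strings without any operator so far,
  the indices 1 to \<^term>\<open>k\<close> for a pending annihilation at that site, the indices \<^term>\<open>k + 1\<close> to
  \<^term>\<open>2 * k\<close> for a pending creation at the sites 1 to \<^term>\<open>k\<close>, and the last index for completed
  strings. In the rows the same holds with \<^term>\<open>k - 1\<close> in place of \<^term>\<open>k\<close>.\<close>

lemma apply_core_left:
  assumes "1 \<le> k" "j < 2 * k" "\<alpha> < 2" "\<beta> < 2"
  shows "array_apply (site_value \<alpha> \<beta>) (core_left T k) x j =
    (if j = 0 then site_value \<alpha> \<beta> mI * x 0 + site_value \<alpha> \<beta> mA * x k + site_value \<alpha> \<beta> mA_adj * x (2 * k)
        + entry T k k * site_value \<alpha> \<beta> (mA_adj * mA) * x (2 * k + 1)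
     else if j < k then site_value \<alpha> \<beta> mS * x j + entry T j k * site_value \<alpha> \<beta> mA_adj * x (2 * k + 1)
     else if j < 2 * k - 1 then site_value \<alpha> \<beta> mS * x (j + 1)
        + entry T k (Suc j - k) * site_value \<alpha> \<beta> mA * x (2 * k + 1)
     else site_value \<alpha> \<beta> mI * x (2 * k + 1))"
proof -
  obtain m where m: "k = Suc m" using assms(1) by (cases k) auto
  have double: "m + m = m * 2" by simp
  have shift: "Suc (i - Suc m) = i - m" if "\<not> i < Suc m" for i using that by simp
  show ?thesis
    using assms unfolding m core_left_def Let_def
    by (auto simp: block_mat_def array_apply_blocks W1_def W2_def algebra_simps double shift)
qed

lemma dim_core_left: "1 \<le> k \<Longrightarrow> dim_row (core_left T k) = 2 * k \<and> dim_col (core_left T k) = 2 * k + 2"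
  by (simp add: core_left_def Let_def block_mat_def)

lemma core_left_is_core: "1 \<le> k \<Longrightarrow> is_core (2 * k) (2 * k + 2) (core_left T k)"
  using dim_core_left[of k T]
  by (simp add: is_core_iff) (simp add: core_left_def Let_def block_mat_def site_entries_blocks)

lemma apply_core_first:
  assumes "\<alpha> < 2" "\<beta> < 2"
  shows "array_apply (site_value \<alpha> \<beta>) (core_first T) x 0 =
    site_value \<alpha> \<beta> mI * x 0 + site_value \<alpha> \<beta> mA * x 1 + site_value \<alpha> \<beta> mA_adj * x 2
        + entry T 1 1 * site_value \<alpha> \<beta> (mA_adj * mA) * x 3"
  using assms by (simp add: core_first_def block_mat_def array_apply_blocks numeral_2_eq_2 numeral_3_eq_3)

lemma core_first_is_core: "is_core 1 4 (core_first T)"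
  by (simp add: is_core_iff core_first_def block_mat_def site_entries_blocks)

text \<open>Here an index records what is still to come: nothing, an annihilation or a creation at one of the
  remaining sites (listed from \<^term>\<open>K\<close> downwards), or everything.\<close>

lemma apply_core_right:
  assumes "k \<le> K" "j < 2 * (K - k) + 4" "\<alpha> < 2" "\<beta> < 2"
  shows "array_apply (site_value \<alpha> \<beta>) (core_right K T k) x j =
    (if j = 0 then site_value \<alpha> \<beta> mI * x 0
     else if j < Suc (K - k) then site_value \<alpha> \<beta> mS * x j
     else if j = Suc (K - k) then site_value \<alpha> \<beta> mA * x 0
     else if j < 2 * Suc (K - k) then site_value \<alpha> \<beta> mS * x (j - 1)
     else if j = 2 * Suc (K - k) then site_value \<alpha> \<beta> mA_adj * x 0
     else entry T k k * site_value \<alpha> \<beta> (mA_adj * mA) * x 0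
       + site_value \<alpha> \<beta> mA_adj * (\<Sum>q<K - k. entry T k (K - q) * x (Suc q))
       + site_value \<alpha> \<beta> mA * (\<Sum>q<K - k. entry T (K - q) k * x (Suc (q + (K - k))))
       + site_value \<alpha> \<beta> mI * x (2 * (K - k) + 1))"
proof -
  define m where "m = K - k"
  have double: "m + m = m * 2" by simp
  have shift: "Suc (j - 2) = j - Suc 0" if "j \<noteq> Suc m" "\<not> j < Suc m" using that by simp
  show ?thesis
    using assms unfolding core_right_def Let_def W3_def W4_def m_def[symmetric]
    by (auto simp: block_mat_def array_apply_blocks algebra_simps double shift)
qed

lemma core_right_is_core: "is_core (2 * (K - k) + 4) (2 * (K - k) + 2) (core_right K T k)"
  by (simp add: is_core_iff core_right_def Let_def block_mat_def site_entries_blocks)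

lemma apply_core_last:
  assumes "j < 4" "\<alpha> < 2" "\<beta> < 2"
  shows "array_apply (site_value \<alpha> \<beta>) (core_last K T) x j =
    (if j = 0 then site_value \<alpha> \<beta> mI else if j = 1 then site_value \<alpha> \<beta> mA
     else if j = 2 then site_value \<alpha> \<beta> mA_adj else entry T K K * site_value \<alpha> \<beta> (mA_adj * mA)) * x 0"
  using assms by (auto simp: core_last_def block_mat_def array_apply_blocks)

lemma core_last_is_core: "is_core 4 1 (core_last K T)"
  by (simp add: is_core_iff core_last_def block_mat_def site_entries_blocks)

lemma apply_M_mat:
  assumes "K = 2 * h" "j < 2 * h + 2"
  shows "array_apply id (M_mat K T) x j =
    (if j = 0 then x (2 * h + 1)
     else if j \<le> h then (\<Sum>q<h. entry T (K - q) j * x (Suc (q + h)))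
     else if j \<le> 2 * h then (\<Sum>q<h. entry T (j - h) (K - q) * x (Suc q))
     else x 0)"
proof -
  have h: "K div 2 = h" using assms by simp
  have W: "array_apply id (W5 K T) y i = (\<Sum>q<h. entry T (Suc i) (K - q) * y q)"
    "array_apply id (W6 K T) y i = (\<Sum>q<h. entry T (K - q) (Suc i) * y q)" if "i < h" for y i
    using that by (simp_all add: array_apply_def W5_def W6_def h)
  have one: "array_apply id (1\<^sub>m (Suc 0)) y 0 = y 0" for y by (simp add: array_apply_def)
  have double: "h + h = 2 * h" by simp
  have shift: "Suc (i - Suc h) = i - h" if "\<not> i \<le> h" for i using that by simp
  show ?thesis
    using assms(2) unfolding M_mat_def Let_def h
    by (auto simp: block_mat_def array_apply_hcat array_apply_vcat array_apply_zero_mat W one h double shift)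
qed

lemma dim_M_mat: "dim_row (M_mat K T) = 2 * (K div 2) + 2" "dim_col (M_mat K T) = 2 * (K div 2) + 2"
  by (simp_all add: M_mat_def Let_def block_mat_def)

section \<open>The columns produced by the cores\<close>

text \<open>The operators on the sites from \<^term>\<open>k\<close> on that belong to these indices, when the sites before
  \<^term>\<open>k\<close> have been read. For the left cores, entry \<^term>\<open>j\<close> is the sum of everything that can complete the string so far, with the coefficients; so a
  pending annihilation at site \<^term>\<open>j\<close> has the weighted sum of all later creations as its entry.\<close>

definition left_col :: "nat \<Rightarrow> real mat \<Rightarrow> nat \<Rightarrow> nat \<Rightarrow> real mat" where
  "left_col K T k j =
    (if j = 0 then op_tail K (entry T) k
     else if j < k then cre_sum K (\<lambda>i. entry T i j) k
     else if j < 2 * k - 1 then ann_sum K (entry T (Suc j - k)) k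
     else 1\<^sub>m (2 ^ (Suc K - k)))"

text \<open>For the right cores, the entries between the first and the last are single operators without
  coefficients: the coefficient of a pair is attached where its first operator is placed, or in the
  middle.\<close>

definition right_col :: "nat \<Rightarrow> real mat \<Rightarrow> nat \<Rightarrow> nat \<Rightarrow> real mat" where
  "right_col K T k j =
    (if j = 0 then 1\<^sub>m (2 ^ (Suc K - k))
     else if j \<le> Suc K - k then ann_tail K k (Suc K - j)
     else if j \<le> 2 * (Suc K - k) then cre_tail K k (Suc K - (j - (Suc K - k)))
     else op_tail K (entry T) k)"

lemma core_stepI:
  assumes "X \<in> carrier_mat (2 ^ (Suc K - k)) (2 ^ (Suc K - k))" "k \<le> K"
    and "\<And>\<alpha> \<beta> a b. \<alpha> < 2 \<Longrightarrow> \<beta> < 2 \<Longrightarrow> a < 2 ^ (K - k) \<Longrightarrow> b < 2 ^ (K - k) \<Longrightarrow>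
      X $$ (\<alpha> * 2 ^ (K - k) + a, \<beta> * 2 ^ (K - k) + b) =
      array_apply (site_value \<alpha> \<beta>) M (\<lambda>j'. V j' $$ (a, b)) j"
  shows "core_step (2 ^ (K - k)) M V j X"
  using assms by (simp add: core_step_def Suc_diff_le site_value_def[abs_def])

lemma left_col_carrier: "left_col K T k j \<in> carrier_mat (2 ^ (Suc K - k)) (2 ^ (Suc K - k))"
  by (simp add: left_col_def)

lemma right_col_carrier:
  assumes "k \<le> K"
  shows "right_col K T k j \<in> carrier_mat (2 ^ (Suc K - k)) (2 ^ (Suc K - k))"
proof (cases "1 \<le> j \<and> j \<le> 2 * (Suc K - k)")
  case True
  then have "k \<le> Suc K - j" "Suc K - j \<le> K" if "j \<le> Suc K - k" using that assms by auto
  moreover have "k \<le> Suc K - (j - (Suc K - k))" "Suc K - (j - (Suc K - k)) \<le> K" if "\<not> j \<le> Suc K - k"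
    using True that assms by auto
  ultimately show ?thesis by (simp add: right_col_def)
qed (auto simp: right_col_def)

text \<open>The four cases are the recursions for splitting off the site \<^term>\<open>k\<close>. A string with a pending
  annihilation at site \<^term>\<open>j\<close> may be completed at site \<^term>\<open>k\<close>, for which the recursion asks the
  coefficient of a creation at \<^term>\<open>k\<close> and an annihilation at \<^term>\<open>j\<close>. The core has the transposed
  coefficient there, so symmetry is essential.\<close>

lemma core_left_step:
  assumes sym: "\<And>i j. i \<in> {1..K} \<Longrightarrow> j \<in> {1..K} \<Longrightarrow> entry T i j = entry T j i"
    and k: "1 \<le> k" "k \<le> K" and j: "j < 2 * k"
  shows "core_step (2 ^ (K - k)) (core_left T k) (left_col K T (Suc k)) j (left_col K T k j)"
proof (rule core_stepI[OF left_col_carrier k(2)])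
  fix \<alpha> \<beta> a b :: nat
  assume d: "\<alpha> < 2" "\<beta> < 2" "a < 2 ^ (K - k)" "b < 2 ^ (K - k)"
  note steps = op_tail_step[OF k refl d] cre_sum_step[OF k refl d] ann_sum_step[OF k refl d]
    one_step[OF k refl d]
  have next_col: "left_col K T (Suc k) 0 = op_tail K (entry T) (Suc k)"
    "left_col K T (Suc k) k = cre_sum K (\<lambda>i. entry T i k) (Suc k)"
    "left_col K T (Suc k) (2 * k) = ann_sum K (entry T k) (Suc k)"
    "left_col K T (Suc k) (2 * k + 1) = 1\<^sub>m (2 ^ (K - k))"
    using k by (simp_all add: left_col_def)
  consider "j = 0" | "0 < j" "j < k" | "k \<le> j" "j < 2 * k - 1" | "k \<le> j" "j = 2 * k - 1"
    using j k by linarith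
  then show "left_col K T k j $$ (\<alpha> * 2 ^ (K - k) + a, \<beta> * 2 ^ (K - k) + b) =
      array_apply (site_value \<alpha> \<beta>) (core_left T k) (\<lambda>j'. left_col K T (Suc k) j' $$ (a, b)) j"
  proof cases
    case 1
    then show ?thesis unfolding apply_core_left[OF k(1) j d(1,2)] next_col
      by (simp add: left_col_def steps site_value_def)
  next
    case 2
    then have "left_col K T k j = cre_sum K (\<lambda>i. entry T i j) k"
      "left_col K T (Suc k) j = cre_sum K (\<lambda>i. entry T i j) (Suc k)" by (simp_all add: left_col_def)
    with 2 sym[of j k] k show ?thesis unfolding apply_core_left[OF k(1) j d(1,2)] next_col
      by (simp add: steps site_value_def)
  next
    case 3
    then have "left_col K T k j = ann_sum K (entry T (Suc j - k)) k"
      "left_col K T (Suc k) (j + 1) = ann_sum K (entry T (Suc j - k)) (Suc k)"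
      using k by (auto simp: left_col_def)
    moreover have "entry T (Suc j - k) k = entry T k (Suc j - k)"
      using 3 k by (intro sym) auto
    ultimately show ?thesis unfolding apply_core_left[OF k(1) j d(1,2)] next_col using 3 k
      by (simp add: steps site_value_def)
  next
    case 4
    then have "left_col K T k j = 1\<^sub>m (2 ^ (Suc K - k))" and "j \<noteq> 0"
      using k by (simp_all add: left_col_def)
    with 4 show ?thesis unfolding apply_core_left[OF k(1) j d(1,2)] next_col
      by (simp add: steps site_value_def)
  qed
qed

lemma core_first_step:
  assumes "1 \<le> K"
  shows "core_step (2 ^ (K - 1)) (core_first T) (left_col K T 2) 0 (left_col K T 1 0)"
proof (rule core_stepI[OF left_col_carrier assms])
  fix \<alpha> \<beta> a b :: nat
  assume d: "\<alpha> < 2" "\<beta> < 2" "a < 2 ^ (K - 1)" "b < 2 ^ (K - 1)"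
  show "left_col K T 1 0 $$ (\<alpha> * 2 ^ (K - 1) + a, \<beta> * 2 ^ (K - 1) + b) =
      array_apply (site_value \<alpha> \<beta>) (core_first T) (\<lambda>j'. left_col K T 2 j' $$ (a, b)) 0"
    unfolding apply_core_first[OF d(1,2)] using op_tail_step[OF le_refl assms refl d]
    by (simp add: left_col_def site_value_def numeral_2_eq_2 numeral_3_eq_3)
qed

text \<open>The blocks of the right cores and of the middle matrix list the sites from \<^term>\<open>K\<close> downwards.\<close>

lemma sum_from_top:
  fixes f :: "nat \<Rightarrow> 'a :: comm_monoid_add"
  assumes "k \<le> K"
  shows "(\<Sum>q<K - k. f (K - q)) = (\<Sum>j=Suc k..K. f j)"
  by (rule sum.reindex_bij_witness[of _ "\<lambda>j. K - j" "\<lambda>q. K - q"]) (use assms in auto)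

lemma sum_ann_tail:
  assumes "k \<le> K" "a < 2 ^ (K - k)" "b < 2 ^ (K - k)"
  shows "(\<Sum>q<K - k. c (K - q) * ann_tail K (Suc k) (K - q) $$ (a, b)) = ann_sum K c (Suc k) $$ (a, b)"
    and "(\<Sum>q<K - k. c (K - q) * cre_tail K (Suc k) (K - q) $$ (a, b)) = cre_sum K c (Suc k) $$ (a, b)"
  using assms sum_from_top[OF assms(1), of "\<lambda>j. c j * ann_tail K (Suc k) j $$ (a, b)"]
    sum_from_top[OF assms(1), of "\<lambda>j. c j * cre_tail K (Suc k) j $$ (a, b)"]
  by (simp_all add: ann_sum_def cre_sum_def)

lemma right_col_sums:
  assumes "k \<le> K" "a < 2 ^ (K - k)" "b < 2 ^ (K - k)"
  shows "(\<Sum>q<K - k. c (K - q) * right_col K T (Suc k) (Suc q) $$ (a, b)) = ann_sum K c (Suc k) $$ (a, b)"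
    and "(\<Sum>q<K - k. c (K - q) * right_col K T (Suc k) (Suc (q + (K - k))) $$ (a, b)) =
      cre_sum K c (Suc k) $$ (a, b)"
proof -
  define m where "m = K - k"
  have size: "Suc K - Suc k = m" "K - k = m" by (simp_all add: m_def)
  have "right_col K T (Suc k) (Suc q) = ann_tail K (Suc k) (K - q)"
    "right_col K T (Suc k) (Suc (q + m)) = cre_tail K (Suc k) (K - q)" if "q < m" for q
  proof -
    have "Suc K - (Suc (q + m) - m) = K - q" by simp
    then show "right_col K T (Suc k) (Suc q) = ann_tail K (Suc k) (K - q)"
      "right_col K T (Suc k) (Suc (q + m)) = cre_tail K (Suc k) (K - q)"
      using that unfolding right_col_def size by simp_all
  qed
  then show "(\<Sum>q<K - k. c (K - q) * right_col K T (Suc k) (Suc q) $$ (a, b)) = ann_sum K c (Suc k) $$ (a, b)"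
    "(\<Sum>q<K - k. c (K - q) * right_col K T (Suc k) (Suc (q + (K - k))) $$ (a, b)) =
      cre_sum K c (Suc k) $$ (a, b)"
    unfolding sum_ann_tail[OF assms, symmetric] size by simp_all
qed

lemma core_right_step:
  assumes k: "1 \<le> k" "k \<le> K" and j: "j < 2 * (K - k) + 4"
  shows "core_step (2 ^ (K - k)) (core_right K T k) (right_col K T (Suc k)) j (right_col K T k j)"
proof (rule core_stepI[OF right_col_carrier[OF k(2)] k(2)])
  fix \<alpha> \<beta> a b :: nat
  assume d: "\<alpha> < 2" "\<beta> < 2" "a < 2 ^ (K - k)" "b < 2 ^ (K - k)"
  define m where "m = K - k"
  have m: "K - k = m" "k = K - m" "m < K" using k by (auto simp: m_def)
  have size: "K - k = m" "Suc K - k = Suc m" "Suc K - Suc k = m" using k by (auto simp: m_def)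
  have next_first: "right_col K T (Suc k) 0 = 1\<^sub>m (2 ^ (K - k))" by (simp add: right_col_def)
  have first: "ann_tail K k k $$ (\<alpha> * 2 ^ (K - k) + a, \<beta> * 2 ^ (K - k) + b) =
      mA $$ (\<alpha>, \<beta>) * 1\<^sub>m (2 ^ (K - k)) $$ (a, b)"
    "cre_tail K k k $$ (\<alpha> * 2 ^ (K - k) + a, \<beta> * 2 ^ (K - k) + b) =
      mA_adj $$ (\<alpha>, \<beta>) * 1\<^sub>m (2 ^ (K - k)) $$ (a, b)"
    unfolding tail_first[OF k refl d]
    by (rule kron_entry[OF site_carrier(2) one_carrier_mat d] kron_entry[OF site_carrier(4) one_carrier_mat d])+
  have later: "ann_tail K k i $$ (\<alpha> * 2 ^ (K - k) + a, \<beta> * 2 ^ (K - k) + b) =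
      mS $$ (\<alpha>, \<beta>) * ann_tail K (Suc k) i $$ (a, b)"
    "cre_tail K k i $$ (\<alpha> * 2 ^ (K - k) + a, \<beta> * 2 ^ (K - k) + b) =
      mS $$ (\<alpha>, \<beta>) * cre_tail K (Suc k) i $$ (a, b)"
    if "k < i" "i \<le> K" for i
    unfolding tail_later[OF k refl d that(1)]
    by (rule kron_entry[OF site_carrier(1) tail_rest_carrier(1)[OF k refl d that] d]
        kron_entry[OF site_carrier(1) tail_rest_carrier(2)[OF k refl d that] d])+
  have "j = 0 \<or> 0 < j \<and> j < Suc m \<or> j = Suc m \<or> Suc m < j \<and> j < 2 * Suc m \<or> j = 2 * Suc m
      \<or> j = 2 * Suc m + 1"
    using j unfolding m(1) by presburger
  then consider "j = 0" | "0 < j" "j < Suc m" | "j = Suc m" | "Suc m < j" "j < 2 * Suc m" | "j = 2 * Suc m"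
    | "j = 2 * Suc m + 1"
    by blast
  then show "right_col K T k j $$ (\<alpha> * 2 ^ (K - k) + a, \<beta> * 2 ^ (K - k) + b) =
      array_apply (site_value \<alpha> \<beta>) (core_right K T k) (\<lambda>j'. right_col K T (Suc k) j' $$ (a, b)) j"
  proof cases
    case 1
    then have "right_col K T k j = 1\<^sub>m (2 ^ (Suc K - k))" by (simp add: right_col_def)
    with 1 one_step[OF k refl d] show ?thesis unfolding apply_core_right[OF k(2) j d(1,2)] next_first
      by (simp add: site_value_def)
  next
    case 2
    then have "k < Suc K - j" "Suc K - j \<le> K" using m by auto
    note later(1)[OF this]
    moreover have "right_col K T k j = ann_tail K k (Suc K - j)"
      "right_col K T (Suc k) j = ann_tail K (Suc k) (Suc K - j)"
      using 2 by (simp_all add: right_col_def size)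
    ultimately show ?thesis unfolding apply_core_right[OF k(2) j d(1,2)] using 2
      by (simp add: site_value_def size)
  next
    case 3
    then have "Suc K - j = k" using m by simp
    then have "right_col K T k j = ann_tail K k k"
      using 3 by (simp add: right_col_def size)
    with 3 first(1) show ?thesis unfolding apply_core_right[OF k(2) j d(1,2)] next_first
      by (simp add: site_value_def size)
  next
    case 4
    then have "k < Suc K - (j - Suc m)" "Suc K - (j - Suc m) \<le> K" using m by auto
    note later(2)[OF this]
    moreover have "j - Suc m = j - 1 - m" by simp
    then have "right_col K T k j = cre_tail K k (Suc K - (j - Suc m))"
      "right_col K T (Suc k) (j - 1) = cre_tail K (Suc k) (Suc K - (j - Suc m))"
      using 4 unfolding right_col_def size by auto
    ultimately show ?thesis unfolding apply_core_right[OF k(2) j d(1,2)] using 4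
      by (simp add: site_value_def size)
  next
    case 5
    then have "Suc K - (j - Suc m) = k" using m by simp
    then have "right_col K T k j = cre_tail K k k"
      using 5 by (simp add: right_col_def size)
    with 5 first(2) show ?thesis unfolding apply_core_right[OF k(2) j d(1,2)] next_first
      by (simp add: site_value_def size)
  next
    case 6
    then have "right_col K T k j = op_tail K (entry T) k"
      "right_col K T (Suc k) (2 * (K - k) + 1) = op_tail K (entry T) (Suc k)"
      by (simp_all add: right_col_def size)
    with 6 show ?thesis unfolding apply_core_right[OF k(2) j d(1,2)] next_first
      using op_tail_step[OF k refl d, of "entry T"]
        right_col_sums(1)[OF k(2) d(3,4), of "entry T k" T]
        right_col_sums(2)[OF k(2) d(3,4), of "\<lambda>i. entry T i k" T]
      by (simp add: site_value_def size)
  qed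
qed

text \<open>With no site to the right of \<^term>\<open>K\<close>, a right core at \<^term>\<open>K\<close> would have two columns, of which the
  second meets the zero operator; dropping it gives the last core.\<close>

lemma core_last_step:
  assumes "1 \<le> K" "j < 4"
  shows "core_step 1 (core_last K T) (right_col K T (Suc K)) j (right_col K T K j)"
proof -
  have "core_step (2 ^ (K - K)) (core_last K T) (right_col K T (Suc K)) j (right_col K T K j)"
  proof (rule core_stepI[OF right_col_carrier[OF le_refl] le_refl])
    fix \<alpha> \<beta> a b :: nat
    assume d: "\<alpha> < 2" "\<beta> < 2" "a < 2 ^ (K - K)" "b < 2 ^ (K - K)"
    have right: "array_apply (site_value \<alpha> \<beta>) (core_right K T K) (\<lambda>j'. right_col K T (Suc K) j' $$ (a, b)) j =
        right_col K T K j $$ (\<alpha> * 2 ^ (K - K) + a, \<beta> * 2 ^ (K - K) + b)"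
      using core_right_step[OF assms(1) le_refl, of j T] assms(2) d
      by (simp add: core_step_def site_value_def[abs_def])
    have "right_col K T (Suc K) 1 = 0\<^sub>m 1 1" by (simp add: right_col_def tail_empty)
    then show "right_col K T K j $$ (\<alpha> * 2 ^ (K - K) + a, \<beta> * 2 ^ (K - K) + b) =
        array_apply (site_value \<alpha> \<beta>) (core_last K T) (\<lambda>j'. right_col K T (Suc K) j' $$ (a, b)) j"
      unfolding right[symmetric] using assms(2) d
      by (auto simp: apply_core_last apply_core_right numeral_eq_Suc less_Suc_eq)
  qed
  then show ?thesis by simp
qed

text \<open>The matrix translates between the two kinds of index: it pairs "nothing so far" with "everything
  to come" and "completed" with "nothing to come", and it attaches to an operator pending on the left
  the weighted sum of its possible partners on the right.\<close>

lemma M_mat_right_col: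
  assumes K: "K = 2 * h" and j: "j < 2 * h + 2" and ab: "a < 2 ^ (K - h)" "b < 2 ^ (K - h)"
  shows "array_apply id (M_mat K T) (\<lambda>j'. right_col K T (Suc h) j' $$ (a, b)) j = left_col K T (Suc h) j $$ (a, b)"
proof -
  have h: "h \<le> K" "K - h = h" "Suc K - Suc h = h" using K by simp_all
  note sums = right_col_sums[OF h(1) ab, unfolded h]
  consider "j = 0" | "0 < j" "j \<le> h" | "h < j" "j \<le> 2 * h" | "j = 2 * h + 1" using j by linarith
  then show ?thesis
  proof cases
    case 1
    then show ?thesis unfolding apply_M_mat[OF K j] by (simp add: left_col_def right_col_def h)
  next
    case 2
    then show ?thesis unfolding apply_M_mat[OF K j]
      using sums(2)[of "\<lambda>i. entry T i j" T] by (simp add: left_col_def)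
  next
    case 3
    then show ?thesis unfolding apply_M_mat[OF K j]
      using sums(1)[of "entry T (j - h)" T] by (simp add: left_col_def)
  next
    case 4
    then show ?thesis unfolding apply_M_mat[OF K j] by (simp add: left_col_def right_col_def h)
  qed
qed

section \<open>The product of the cores\<close>

text \<open>The matrix is multiplied into the core to its left, which makes the factorization a
  representation with one core per site.\<close>

definition op_core :: "nat \<Rightarrow> real mat \<Rightarrow> nat \<Rightarrow> core" where
  "op_core K T k = (if k = K div 2 then core_mult (T_core K T k) (M_mat K T) else T_core K T k)"

definition op_rank :: "nat \<Rightarrow> nat \<Rightarrow> nat" where
  "op_rank K k = (if k = 0 \<or> k = K then 1 else if k \<le> K div 2 then 2 * k + 2 else 2 * (K - k) + 2)"

definition op_col :: "nat \<Rightarrow> real mat \<Rightarrow> nat \<Rightarrow> nat \<Rightarrow> real mat" where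
  "op_col K T k = (if k \<le> K div 2 then left_col K T k else right_col K T k)"

lemma T_core_is_core:
  assumes "K = 2 * h" "1 \<le> h" "1 \<le> k" "k \<le> K"
  shows "is_core (op_rank K (k - 1)) (if k = h then 2 * h + 2 else op_rank K k) (T_core K T k)"
proof -
  consider "k = 1" | "k = K" "k \<noteq> 1" | "1 < k" "k \<le> h" | "h < k" "k < K" using assms by linarith
  then show ?thesis
  proof cases
    case 1
    then have "op_rank K (k - 1) = 1" "(if k = h then 2 * h + 2 else op_rank K k) = 4"
      using assms by (auto simp: op_rank_def)
    with 1 show ?thesis using core_first_is_core[of T] by (simp add: T_core_def)
  next
    case 2
    then have "op_rank K (k - 1) = 4" "op_rank K k = 1" "k \<noteq> h"
      using assms by (auto simp: op_rank_def)
    with 2 show ?thesis using core_last_is_core[of K T] by (simp add: T_core_def)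
  next
    case 3
    then have "op_rank K (k - 1) = 2 * k" "k \<noteq> h \<Longrightarrow> op_rank K k = 2 * k + 2" "k \<noteq> K" "k \<le> K div 2"
      using assms by (auto simp: op_rank_def)
    with 3 show ?thesis using core_left_is_core[of k T] by (auto simp: T_core_def)
  next
    case 4
    then have "op_rank K (k - 1) = 2 * (K - k) + 4" "op_rank K k = 2 * (K - k) + 2" "k \<noteq> 1" "\<not> k \<le> K div 2"
      using assms by (auto simp: op_rank_def)
    with 4 show ?thesis using core_right_is_core[of K k T] by (simp add: T_core_def)
  qed
qed

lemma op_core_is_core:
  assumes "K = 2 * h" "1 \<le> h" "k \<in> {1..K}"
  shows "is_core (op_rank K (k - 1)) (op_rank K k) (op_core K T k)"
proof -
  have core: "is_core (op_rank K (k - 1)) (if k = h then 2 * h + 2 else op_rank K k) (T_core K T k)"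
    using T_core_is_core[OF assms(1,2)] assms(3) by simp
  show ?thesis
  proof (cases "k = h")
    case True
    with assms have "op_rank K k = 2 * h + 2" by (simp add: op_rank_def)
    with True core assms show ?thesis
      by (simp add: op_core_def is_core_iff site_entries_core_mult dim_M_mat)
  next
    case False
    with core assms show ?thesis by (simp add: op_core_def)
  qed
qed

lemma T_core_left_step:
  assumes sym: "\<And>i j. i \<in> {1..K} \<Longrightarrow> j \<in> {1..K} \<Longrightarrow> entry T i j = entry T j i"
    and "K = 2 * h" "1 \<le> k" "k \<le> h" "j < op_rank K (k - 1)"
  shows "core_step (2 ^ (K - k)) (T_core K T k) (left_col K T (Suc k)) j (left_col K T k j)"
proof (cases "k = 1")
  case True
  then show ?thesis using core_first_step[of K T] assms by (simp add: T_core_def op_rank_def numeral_2_eq_2)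
next
  case False
  with assms have "op_rank K (k - 1) = 2 * k" "T_core K T k = core_left T k"
    by (auto simp: op_rank_def T_core_def)
  then show ?thesis using core_left_step[OF sym, of K k j] assms by simp
qed

text \<open>This separates the middle matrix from the core to its left: the core only sees the column
  \<^term>\<open>U\<close> into which the matrix turns \<^term>\<open>V\<close>.\<close>

lemma core_step_core_mult:
  assumes "core_step N M U j X" "site_entries M" "j < dim_row M" "dim_row G = dim_col M"
    and "\<And>j' a b. j' < dim_row G \<Longrightarrow> a < N \<Longrightarrow> b < N \<Longrightarrow>
      array_apply id G (\<lambda>i. V i $$ (a, b)) j' = U j' $$ (a, b)"
  shows "core_step N (core_mult M G) V j X"
  using assms(1) unfolding core_step_def
proof (intro conjI allI impI; elim conjE)
  fix \<alpha> \<beta> a b :: nat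
  assume d: "\<alpha> < 2" "\<beta> < 2" "a < N" "b < N"
    and step: "\<forall>\<alpha><2. \<forall>\<beta><2. \<forall>a<N. \<forall>b<N. X $$ (\<alpha> * N + a, \<beta> * N + b) =
      array_apply (\<lambda>B. B $$ (\<alpha>, \<beta>)) M (\<lambda>j'. U j' $$ (a, b)) j"
  have "array_apply (\<lambda>B. B $$ (\<alpha>, \<beta>)) (core_mult M G) (\<lambda>i. V i $$ (a, b)) j =
      array_apply (\<lambda>B. B $$ (\<alpha>, \<beta>)) M (\<lambda>j'. U j' $$ (a, b)) j"
    unfolding array_apply_core_mult[OF assms(2,3) d(1,2)]
    using assms(4,5) d by (simp add: array_apply_def[of _ M])
  then show "X $$ (\<alpha> * N + a, \<beta> * N + b) =
      array_apply (\<lambda>B. B $$ (\<alpha>, \<beta>)) (core_mult M G) (\<lambda>j'. V j' $$ (a, b)) j"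
    using step d by simp
qed

lemma op_core_step:
  assumes sym: "\<And>i j. i \<in> {1..K} \<Longrightarrow> j \<in> {1..K} \<Longrightarrow> entry T i j = entry T j i"
    and K: "K = 2 * h" "1 \<le> h" and k: "k \<in> {1..K}" and j: "j < op_rank K (k - 1)"
  shows "core_step (2 ^ (K - k)) (op_core K T k) (op_col K T (Suc k)) j (op_col K T k j)"
proof -
  consider "k < h" | "k = h" | "h < k" "k < K" | "k = K" "k \<noteq> h" using K k by fastforce
  then show ?thesis
  proof cases
    case 1
    then show ?thesis using T_core_left_step[OF sym K(1), of k j] K k j by (simp add: op_core_def op_col_def)
  next
    case 2
    have core: "is_core (op_rank K (k - 1)) (2 * h + 2) (T_core K T k)"
      using T_core_is_core[OF K, of k T] k 2 by simp
    have "core_step (2 ^ (K - k)) (core_mult (T_core K T k) (M_mat K T)) (right_col K T (Suc k)) j (left_col K T k j)"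
    proof (rule core_step_core_mult[where U = "left_col K T (Suc k)"])
      show "core_step (2 ^ (K - k)) (T_core K T k) (left_col K T (Suc k)) j (left_col K T k j)"
        using T_core_left_step[OF sym K(1), of k j] k j 2 by simp
      show "array_apply id (M_mat K T) (\<lambda>i. right_col K T (Suc k) i $$ (a, b)) j' = left_col K T (Suc k) j' $$ (a, b)"
        if "j' < dim_row (M_mat K T)" "a < 2 ^ (K - k)" "b < 2 ^ (K - k)" for j' a b
        using M_mat_right_col[OF K(1), of j' a b T] that 2 K by (simp add: dim_M_mat)
    qed (use core j K in \<open>auto simp: is_core_iff dim_M_mat\<close>)
    then show ?thesis using 2 K by (simp add: op_core_def op_col_def)
  next
    case 3
    then have "op_rank K (k - 1) = 2 * (K - k) + 4" "op_core K T k = core_right K T k"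
      using K by (auto simp: op_rank_def op_core_def T_core_def)
    then show ?thesis using core_right_step[of k K j T] 3 K k j by (simp add: op_col_def)
  next
    case 4
    then have "op_rank K (k - 1) = 4" "op_core K T k = core_last K T"
      using K by (auto simp: op_rank_def op_core_def T_core_def)
    then show ?thesis using core_last_step[of K j T] 4 K k j by (simp add: op_col_def)
  qed
qed

lemma op_core_representation:
  assumes sym: "\<And>i j. i \<in> {1..K} \<Longrightarrow> j \<in> {1..K} \<Longrightarrow> entry T i j = entry T j i"
    and K: "K = 2 * h" "1 \<le> h"
  shows "mpo_representation K (op_rank K) (op_core K T) (one_particle_op K T)"
proof -
  have "mpo_prod (map (op_core K T) [1..<Suc K]) = column (op_rank K (1 - 1)) (op_col K T 1)"
    by (rule mpo_prod_eq_column[where V = "op_col K T", OF op_core_is_core[OF K] _ _ op_core_step[OF sym K]])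
      (use K in \<open>auto simp: op_rank_def op_col_def right_col_def\<close>)
  also have "\<dots> = single (one_particle_op K T)"
    using K by (auto simp: column_def single_def op_rank_def op_col_def left_col_def op_tail_1[unfolded One_nat_def])
  finally show ?thesis
    using op_core_is_core[OF K] by (auto simp: mpo_representation_def op_rank_def)
qed

section \<open>Shift registers for banded coefficients\<close>

definition shift_core :: "nat \<Rightarrow> core" where
  "shift_core d = mat d d (\<lambda>(p, q). if q = Suc p then mS else 0\<^sub>m 2 2)"

definition insert_core :: "nat \<Rightarrow> real mat \<Rightarrow> core" where
  "insert_core d B = mat 1 d (\<lambda>(_, q). if q = 0 then B else 0\<^sub>m 2 2)"

text \<open>A pending operator is remembered only for \<^term>\<open>d\<close> sites. After the site \<^term>\<open>k\<close>, slot
  \<^term>\<open>q\<close> of a register holds a pending operator at site \<^term>\<open>k - q\<close>: a new operator enters slot 0,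
  each further site shifts the contents by one slot, and what leaves the register is too far away to
  have a partner. All these cores have the same size, also near the ends of the chain, where some slots
  stand for sites that do not exist.\<close>

definition register_core :: "(nat \<Rightarrow> nat \<Rightarrow> real) \<Rightarrow> nat \<Rightarrow> nat \<Rightarrow> core" where
  "register_core t d k = (let Z = zero_core in block_mat
     [[single mI, insert_core d mA, insert_core d mA_adj, single (t k k \<cdot>\<^sub>m (mA_adj * mA))],
      [Z d 1, shift_core d, Z d d, mat d 1 (\<lambda>(p, _). t k (k - Suc p)) \<up> mA_adj],
      [Z d 1, Z d d, shift_core d, mat d 1 (\<lambda>(p, _). t (k - Suc p) k) \<up> mA],
      [Z 1 1, Z 1 d, Z 1 d, single mI]])"

text \<open>Before the site \<^term>\<open>k\<close>, index \<^term>\<open>j\<close> with \<^term>\<open>1 \<le> j\<close> and \<^term>\<open>j \<le> d\<close> stands for site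
  \<^term>\<open>k - j\<close>. If there is no such site, the truncated difference is 0, so that coefficients that
  vanish at 0 make the entry vanish.\<close>

definition register_col :: "nat \<Rightarrow> (nat \<Rightarrow> nat \<Rightarrow> real) \<Rightarrow> nat \<Rightarrow> nat \<Rightarrow> nat \<Rightarrow> real mat" where
  "register_col K t d k j =
    (if j = 0 then op_tail K t k
     else if j \<le> d then cre_sum K (\<lambda>i. t i (k - j)) k
     else if j \<le> 2 * d then ann_sum K (t (k - (j - d))) k
     else 1\<^sub>m (2 ^ (Suc K - k)))"

lemma dim_register_pieces [simp]:
  "dim_row (shift_core d) = d" "dim_col (shift_core d) = d"
  "dim_row (insert_core d B) = 1" "dim_col (insert_core d B) = d"
  by (simp_all add: shift_core_def insert_core_def)

lemma array_apply_shift_core: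
  assumes "j < d" "\<phi> (0\<^sub>m 2 2) = 0"
  shows "array_apply \<phi> (shift_core d) x j = (if Suc j < d then \<phi> mS * x (Suc j) else 0)"
proof -
  have "array_apply \<phi> (shift_core d) x j = (\<Sum>i<d. (if i = Suc j then \<phi> mS else 0) * x i)"
    using assms by (auto simp: array_apply_def shift_core_def intro!: sum.cong)
  then show ?thesis by (simp add: sum_delta_times)
qed

lemma array_apply_insert_core:
  assumes "j = 0" "\<phi> (0\<^sub>m 2 2) = 0"
  shows "array_apply \<phi> (insert_core d B) x j = (if 0 < d then \<phi> B * x 0 else 0)"
proof -
  have "array_apply \<phi> (insert_core d B) x j = (\<Sum>i<d. (if i = 0 then \<phi> B else 0) * x i)"
    using assms by (auto simp: array_apply_def insert_core_def intro!: sum.cong)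
  then show ?thesis by (simp add: sum_delta_times)
qed

lemma site_entries_register_pieces:
  "site_entries (shift_core d)" "B \<in> carrier_mat 2 2 \<Longrightarrow> site_entries (insert_core d B)"
  by (simp_all add: site_entries_def shift_core_def insert_core_def)

lemma apply_register_core:
  assumes "j < 2 * d + 2" "\<alpha> < 2" "\<beta> < 2"
  shows "array_apply (site_value \<alpha> \<beta>) (register_core t d k) x j =
    (if j = 0 then site_value \<alpha> \<beta> mI * x 0 + (if 0 < d then site_value \<alpha> \<beta> mA * x 1 else 0)
        + (if 0 < d then site_value \<alpha> \<beta> mA_adj * x (Suc d) else 0)
        + t k k * site_value \<alpha> \<beta> (mA_adj * mA) * x (2 * d + 1)
     else if j \<le> d then (if j < d then site_value \<alpha> \<beta> mS * x (Suc j) else 0)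
        + t k (k - j) * site_value \<alpha> \<beta> mA_adj * x (2 * d + 1)
     else if j \<le> 2 * d then (if j < 2 * d then site_value \<alpha> \<beta> mS * x (Suc j) else 0)
        + t (k - (j - d)) k * site_value \<alpha> \<beta> mA * x (2 * d + 1)
     else site_value \<alpha> \<beta> mI * x (2 * d + 1))"
proof -
  have double: "d + d = d * 2" by simp
  have shift: "Suc (i - Suc d) = i - d" if "\<not> i \<le> d" for i using that by simp
  show ?thesis
    using assms unfolding register_core_def Let_def
    by (auto simp: block_mat_def array_apply_blocks array_apply_shift_core array_apply_insert_core
        algebra_simps double shift)
qed

lemma register_core_is_core: "is_core (2 * d + 2) (2 * d + 2) (register_core t d k)"
  by (simp add: is_core_iff register_core_def Let_def block_mat_def site_entries_blocks
      site_entries_register_pieces)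

lemma sums_zero:
  assumes "\<And>j. k \<le> j \<Longrightarrow> j \<le> K \<Longrightarrow> c j = 0"
  shows "cre_sum K c k = 0\<^sub>m (2 ^ (Suc K - k)) (2 ^ (Suc K - k))"
    and "ann_sum K c k = 0\<^sub>m (2 ^ (Suc K - k)) (2 ^ (Suc K - k))"
  using assms by (auto simp: cre_sum_def ann_sum_def intro!: eq_matI sum.neutral)

text \<open>The entry that leaves the register is a sum over coefficients of distance more than \<^term>\<open>d\<close>, hence
  zero. For \<^term>\<open>d = 0\<close> the registers are empty, and the same happens to an operator that would have
  entered them.\<close>

lemma register_core_step:
  assumes band: "\<And>i j. i + d < j \<or> j + d < i \<Longrightarrow> t i j = 0" and zero: "\<And>i. t i 0 = 0" "\<And>i. t 0 i = 0"
    and k: "1 \<le> k" "k \<le> K" and j: "j < 2 * d + 2"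
  shows "core_step (2 ^ (K - k)) (register_core t d k) (register_col K t d (Suc k)) j (register_col K t d k j)"
proof (rule core_stepI[OF _ k(2)])
  show "register_col K t d k j \<in> carrier_mat (2 ^ (Suc K - k)) (2 ^ (Suc K - k))"
    by (simp add: register_col_def)
  fix \<alpha> \<beta> a b :: nat
  assume ab: "\<alpha> < 2" "\<beta> < 2" "a < 2 ^ (K - k)" "b < 2 ^ (K - k)"
  note steps = op_tail_step[OF k refl ab] cre_sum_step[OF k refl ab] ann_sum_step[OF k refl ab]
    one_step[OF k refl ab]
  \<comment> \<open>The truncated difference is either the true site, which is out of reach, or 0.\<close>
  have gone: "t i (k - d) = 0" "t (k - d) i = 0" if "Suc k \<le> i" for i
    using band[of i "k - d"] band[of "k - d" i] zero that by (cases "d < k"; simp)+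
  have next_col: "register_col K t d (Suc k) 0 = op_tail K t (Suc k)"
    "register_col K t d (Suc k) (2 * d + 1) = 1\<^sub>m (2 ^ (K - k))"
    by (simp_all add: register_col_def)
  have "j = 0 \<or> 0 < j \<and> j \<le> d \<or> d < j \<and> j \<le> 2 * d \<or> j = 2 * d + 1" using j by linarith
  then consider "j = 0" | "0 < j" "j \<le> d" | "d < j" "j \<le> 2 * d" | "j = 2 * d + 1" by blast
  then show "register_col K t d k j $$ (\<alpha> * 2 ^ (K - k) + a, \<beta> * 2 ^ (K - k) + b) =
      array_apply (site_value \<alpha> \<beta>) (register_core t d k) (\<lambda>j'. register_col K t d (Suc k) j' $$ (a, b)) j"
  proof cases
    case 1
    have "register_col K t d (Suc k) 1 = cre_sum K (\<lambda>i. t i k) (Suc k)"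
      "register_col K t d (Suc k) (Suc d) = ann_sum K (t k) (Suc k)" if "0 < d"
      using that by (simp_all add: register_col_def)
    moreover have "cre_sum K (\<lambda>i. t i k) (Suc k) $$ (a, b) = 0" "ann_sum K (t k) (Suc k) $$ (a, b) = 0" if "d = 0"
      using that ab sums_zero(1)[of "Suc k" K "\<lambda>i. t i k"] sums_zero(2)[of "Suc k" K "t k"] band
      by simp_all
    moreover have "register_col K t d k j = op_tail K t k" using 1 by (simp add: register_col_def)
    ultimately show ?thesis unfolding apply_register_core[OF j ab(1,2)] next_col using 1
      by (cases "d = 0") (simp_all add: steps site_value_def)
  next
    case 2
    have "register_col K t d (Suc k) (Suc j) = cre_sum K (\<lambda>i. t i (k - j)) (Suc k)" if "j < d"
      using that by (simp add: register_col_def)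
    moreover have "cre_sum K (\<lambda>i. t i (k - j)) (Suc k) $$ (a, b) = 0" if "j = d"
      using that ab sums_zero(1)[of "Suc k" K "\<lambda>i. t i (k - d)"] gone by simp
    moreover have "register_col K t d k j = cre_sum K (\<lambda>i. t i (k - j)) k"
      using 2 by (simp add: register_col_def)
    ultimately show ?thesis unfolding apply_register_core[OF j ab(1,2)] next_col using 2
      by (cases "j = d") (simp_all add: steps site_value_def)
  next
    case 3
    have "register_col K t d (Suc k) (Suc j) = ann_sum K (t (k - (j - d))) (Suc k)" if "j < 2 * d"
      using that 3 by (simp add: register_col_def Suc_diff_le)
    moreover have "ann_sum K (t (k - (j - d))) (Suc k) $$ (a, b) = 0" if "j = 2 * d"
      using that ab sums_zero(2)[of "Suc k" K "t (k - d)"] gone by simp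
    moreover have "register_col K t d k j = ann_sum K (t (k - (j - d))) k"
      using 3 by (simp add: register_col_def)
    ultimately show ?thesis unfolding apply_register_core[OF j ab(1,2)] next_col using 3
      by (cases "j = 2 * d") (simp_all add: steps site_value_def)
  next
    case 4
    then have "register_col K t d k j = 1\<^sub>m (2 ^ (Suc K - k))" by (simp add: register_col_def)
    with 4 show ?thesis unfolding apply_register_core[OF j ab(1,2)] next_col
      by (simp add: steps site_value_def)
  qed
qed

text \<open>At the ends of the chain only the row of empty strings and the column of completed strings are
  kept.\<close>

definition closed_register_core :: "nat \<Rightarrow> (nat \<Rightarrow> nat \<Rightarrow> real) \<Rightarrow> nat \<Rightarrow> nat \<Rightarrow> core" where
  "closed_register_core K t d k = (let M = register_core t d k in
     if k = 1 then mat 1 (2 * d + 2) (\<lambda>(_, j'). M $$ (0, j'))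
     else if k = K then mat (2 * d + 2) 1 (\<lambda>(j, _). M $$ (j, 2 * d + 1))
     else M)"

lemma register_representation:
  assumes band: "\<And>i j. i + d < j \<or> j + d < i \<Longrightarrow> t i j = 0" and zero: "\<And>i. t i 0 = 0" "\<And>i. t 0 i = 0"
    and t: "\<And>i j. i \<in> {1..K} \<Longrightarrow> j \<in> {1..K} \<Longrightarrow> t i j = entry T i j" and K: "2 \<le> K"
  shows "mpo_representation K (\<lambda>k. if k = 0 \<or> k = K then 1 else 2 * d + 2) (closed_register_core K t d)
    (one_particle_op K T)"
proof -
  define r where "r k = (if k = 0 \<or> k = K then 1 else 2 * d + 2)" for k
  \<comment> \<open>The last core has a single column, so the vector behind it must be reindexed: its only entry is
    the last entry of the register column, the only one that is nonzero.\<close>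
  define V where "V k j = (if k = Suc K then 1\<^sub>m 1 else register_col K t d k j)" for k j
  have core: "is_core (r (k - 1)) (r k) (closed_register_core K t d k)" if "k \<in> {1..K}" for k
    using that K register_core_is_core[of d t k]
    by (auto simp: is_core_def closed_register_core_def Let_def r_def)
  have step: "core_step (2 ^ (K - k)) (closed_register_core K t d k) (V (Suc k)) j (V k j)"
    if k: "k \<in> {1..K}" and j: "j < r (k - 1)" for k j
  proof -
    have "j < 2 * d + 2" using j by (simp add: r_def split: if_splits)
    then have base: "core_step (2 ^ (K - k)) (register_core t d k) (register_col K t d (Suc k)) j (register_col K t d k j)"
      using k by (intro register_core_step[where t = t and d = d, OF band zero]) auto
    have Vk: "V k = register_col K t d k" using k by (auto simp: V_def)
    have dims: "dim_col (register_core t d k) = 2 * d + 2" "dim_row (register_core t d k) = 2 * d + 2"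
      using register_core_is_core[of d t k] by (simp_all add: is_core_iff)
    consider "k = 1" | "k = K" "k \<noteq> 1" | "k \<noteq> 1" "k \<noteq> K" by blast
    then show ?thesis
    proof cases
      case 1
      then have "V (Suc k) = register_col K t d (Suc k)" "j = 0"
        using K j by (auto simp: V_def r_def)
      with 1 base dims Vk show ?thesis
        by (simp add: core_step_def array_apply_def closed_register_core_def Let_def)
    next
      case 2
      have last: "register_col K t d (Suc K) i $$ (0, 0) = (if i = 2 * d + 1 then 1 else 0)" if "i < 2 * d + 2" for i
        using that by (auto simp: register_col_def tail_empty)
      have "array_apply \<phi> (register_core t d K) (\<lambda>i. register_col K t d (Suc K) i $$ (0, 0)) j =
          array_apply \<phi> (closed_register_core K t d K) (\<lambda>i. V (Suc K) i $$ (0, 0)) j" for \<phi>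
      proof -
        have "array_apply \<phi> (register_core t d K) (\<lambda>i. register_col K t d (Suc K) i $$ (0, 0)) j =
            (\<Sum>i<2 * d + 2. (if i = 2 * d + 1 then \<phi> (register_core t d K $$ (j, i)) else 0) * 1)"
          unfolding array_apply_def using dims(1) last 2 by (intro sum.cong) auto
        also have "\<dots> = \<phi> (register_core t d K $$ (j, 2 * d + 1))"
          by (simp only: sum_delta_times) simp
        finally show ?thesis using 2 \<open>j < 2 * d + 2\<close>
          by (simp add: array_apply_def closed_register_core_def Let_def V_def)
      qed
      with 2 base Vk show ?thesis by (simp add: core_step_def)
    next
      case 3
      with k have "V (Suc k) = register_col K t d (Suc k)" by (auto simp: V_def)
      with 3 Vk base show ?thesis by (simp add: closed_register_core_def)
    qed
  qed
  have "mpo_prod (map (closed_register_core K t d) [1..<Suc K]) = column (r (1 - 1)) (V 1)"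
    by (rule mpo_prod_eq_column[where V = V, OF core _ _ step]) (use K in \<open>auto simp: r_def V_def\<close>)
  also have "\<dots> = single (op_tail K t 1)"
    using K by (auto simp: column_def single_def r_def V_def register_col_def)
  also have "op_tail K t 1 = op_tail K (entry T) 1"
    using t by (auto simp: op_tail_def intro!: eq_matI sum.cong)
  finally show ?thesis
    using core by (auto simp: mpo_representation_def r_def op_tail_1[symmetric])
qed

section \<open>Factorization and rank bounds\<close>

theorem theorem5p4:
  fixes K :: nat and T :: "real mat"
  assumes "K \<ge> 2" and "even K"
    and "T \<in> carrier_mat K K" and "transpose_mat T = T"
  shows "mpo_prod (map (T_core K T) [1..<K div 2]
             @ [core_mult (T_core K T (K div 2)) (M_mat K T)]
             @ map (T_core K T) [K div 2 + 1..<Suc K])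
           = single (one_particle_op K T)
         \<and> mpo_ranks_bounded K (one_particle_op K T) (K + 2)
         \<and> (\<forall>d :: nat.
              (\<forall>i\<in>{1..K}. \<forall>j\<in>{1..K}. \<bar>int i - int j\<bar> > int d \<longrightarrow> entry T i j = 0)
              \<longrightarrow> mpo_ranks_bounded K (one_particle_op K T) (2 * d + 2))"
proof -
  obtain h where K: "K = 2 * h" "1 \<le> h" using assms(1,2) by (auto elim!: evenE)
  have sym: "entry T i j = entry T j i" if "i \<in> {1..K}" "j \<in> {1..K}" for i j
  proof -
    have "i - 1 < K" "j - 1 < K" using that by auto
    then have "transpose_mat T $$ (i - 1, j - 1) = T $$ (j - 1, i - 1)" using assms(3) by simp
    then show ?thesis using assms(4) by (simp add: entry_def)
  qed
  have rep: "mpo_representation K (op_rank K) (op_core K T) (one_particle_op K T)"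
    by (rule op_core_representation[OF sym K])
  have "map (T_core K T) [1..<K div 2] @ [core_mult (T_core K T (K div 2)) (M_mat K T)]
      @ map (T_core K T) [K div 2 + 1..<Suc K] = map (op_core K T) [1..<Suc K]"
  proof -
    have "[1..<Suc K] = [1..<h] @ [h] @ [h + 1..<Suc K]"
      using K upt_add_eq_append[of 1 h "Suc K - h"] upt_conv_Cons[of h "Suc K"] by (simp add: mult_2)
    then show ?thesis using K by (simp add: op_core_def del: upt_Suc)
  qed
  then have product: "mpo_prod (map (T_core K T) [1..<K div 2]
      @ [core_mult (T_core K T (K div 2)) (M_mat K T)]
      @ map (T_core K T) [K div 2 + 1..<Suc K]) = single (one_particle_op K T)"
    using rep by (simp add: mpo_representation_def)
  have "op_rank K k \<le> K + 2" for k using K by (auto simp: op_rank_def)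
  with rep have bound: "mpo_ranks_bounded K (one_particle_op K T) (K + 2)"
    unfolding mpo_ranks_bounded_def by blast
  have banded: "mpo_ranks_bounded K (one_particle_op K T) (2 * d + 2)"
    if d: "\<forall>i\<in>{1..K}. \<forall>j\<in>{1..K}. \<bar>int i - int j\<bar> > int d \<longrightarrow> entry T i j = 0" for d
  proof -
    \<comment> \<open>Cut off outside the chain, because the empty slots of the registers refer to site 0.\<close>
    define t where "t i j = (if i \<in> {1..K} \<and> j \<in> {1..K} then entry T i j else 0)" for i j
    have "mpo_representation K (\<lambda>k. if k = 0 \<or> k = K then 1 else 2 * d + 2) (closed_register_core K t d)
        (one_particle_op K T)"
      by (rule register_representation) (use d assms(1) in \<open>auto simp: t_def\<close>)
    then show ?thesis unfolding mpo_ranks_bounded_def by fastforce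
  qed
  show ?thesis using product bound banded by blast
qed

end
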